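(* Assume that $X$ satisfies the Hörmander condition on $\Omega$. Let $H:\Omega\times\mathbb{R}\times\mathbb{R}^m\to\mathbb{R}$ be a continuous function such that $p\mapsto H(x,s,p)$ is quasiconvex for every $x\in\Omega$ and $s\in\mathbb{R}$. Let $u\in W^{1,\infty}_{X,loc}(\Omega)$ be such that $$H(x,u(x),Xu(x))\le0\quad\text{for a.e. }x\in\Omega .$$ Then $u$ is a viscosity subsolution to $H(x,u(x),Xu(x))=0$ in $\Omega$.
   Context: Let $m\le n$ be positive integers, $\Omega\subset\mathbb{R}^n$ a bounded domain, $X=(X_1,\dots,X_m)$ with $X_j=\sum_{i=1}^n c_{j,i}\,\partial/\partial x_i$ smooth vector fields on $\Omega$, and $C(x)=[c_{j,i}(x)]$ the $m\times n$ coefficient matrix. Hörmander condition on $\Omega$: $\dim\operatorname{Lie}(X_1,\dots,X_m)(x)=n$ for every $x\in\Omega$. For $u\in L^1_{loc}(\Omega)$, $Xu=(X_1u,\dots,X_mu)$ is the distributional horizontal gradient: $\langle Xu,\varphi\rangle=-\int_\Omega u\operatorname{div}(\varphi\cdot C(x))\,dx$ for $\varphi\in C_c^\infty(\Omega,\mathbb{R}^m)$. $C^1_X(\Omega)=\{u\in C(\Omega): X_ju\in C(\Omega),\ j=1,\dots,m\}$. $W^{1,\infty}_{X,loc}(\Omega)$ is the set of $u\in L^\infty_{loc}(\Omega)$ with $u|_V\in L^\infty(V)$ and $Xu|_V\in L^\infty(V,\mathbb{R}^m)$ for every open $V$ with $\overline V\subset\Omega$ compact; such functions are identified with their continuous representatives.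 A function $h:\mathbb{R}^m\to\mathbb{R}$ is quasiconvex if $h(t\xi+(1-t)\eta)\le\max\{h(\xi),h(\eta)\}$ for all $\xi,\eta\in\mathbb{R}^m$, $t\in[0,1]$. An upper semicontinuous $u$ on $\Omega$ is a viscosity subsolution to $H(x,u(x),Xu(x))=0$ in $\Omega$ if $H(x_0,u(x_0),X\varphi(x_0))\le0$ for every $x_0\in\Omega$ and every $\varphi\in C^1_X(\Omega)$ such that $u(x_0)-\varphi(x_0)\ge u(x)-\varphi(x)$ for all $x$ in a neighborhood of $x_0$. *)

theory Defs
  imports "HOL-Analysis.Analysis"
begin

text \<open>
  All functions on a domain \<open>\<Omega>\<close> are total functions on the ambient space; every notion below
  depends only on their values on the open set at hand.
\<close>

fun Ck_on :: "nat \<Rightarrow> 'a::real_normed_vector set \<Rightarrow> ('a \<Rightarrow> 'b::real_normed_vector) \<Rightarrow> bool" where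
  "Ck_on 0 S f \<longleftrightarrow> continuous_on S f"
| "Ck_on (Suc k) S f \<longleftrightarrow>
     (\<forall>x\<in>S. f differentiable (at x)) \<and> (\<forall>v. Ck_on k S (\<lambda>x. frechet_derivative f (at x) v))"

text \<open>Only used for open \<open>S\<close>.\<close>

definition smooth_on :: "'a::real_normed_vector set \<Rightarrow> ('a \<Rightarrow> 'b::real_normed_vector) \<Rightarrow> bool" where
  "smooth_on S f \<longleftrightarrow> (\<forall>k. Ck_on k S f)"

text \<open>
  A vector field \<open>\<Sum>i. V\<^sub>i \<partial>/\<partial>x\<^sub>i\<close> is identified with its coefficient
  function \<open>V\<close>; the bracket has coefficients \<open>V(W\<^sub>i) - W(V\<^sub>i)\<close>.
\<close>

definition lie_bracket :: "(real^'n \<Rightarrow> real^'n) \<Rightarrow> (real^'n \<Rightarrow> real^'n) \<Rightarrow> real^'n \<Rightarrow> real^'n" where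
  "lie_bracket V W = (\<lambda>x. frechet_derivative W (at x) (V x) - frechet_derivative V (at x) (W x))"

text \<open>
  The matrix field \<open>C :: real^'n \<Rightarrow> real^'n^'m\<close> has the coefficients of \<open>X\<^sub>j\<close> as its
  \<open>j\<close>-th row, so \<open>X\<^sub>j\<close> is \<open>\<lambda>x. C x $ j\<close>. The set \<open>Lie C\<close> is the real Lie algebra generated by
  these fields.
\<close>

inductive_set Lie :: "(real^'n \<Rightarrow> real^'n^'m) \<Rightarrow> (real^'n \<Rightarrow> real^'n) set"
  for C :: "real^'n \<Rightarrow> real^'n^'m" where
  gen: "(\<lambda>x. C x $ j) \<in> Lie C"
| add: "V \<in> Lie C \<Longrightarrow> W \<in> Lie C \<Longrightarrow> (\<lambda>x. V x + W x) \<in> Lie C"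
| scale: "V \<in> Lie C \<Longrightarrow> (\<lambda>x. a *\<^sub>R V x) \<in> Lie C"
| bracket: "V \<in> Lie C \<Longrightarrow> W \<in> Lie C \<Longrightarrow> lie_bracket V W \<in> Lie C"

definition hormander_on :: "(real^'n) set \<Rightarrow> (real^'n \<Rightarrow> real^'n^'m) \<Rightarrow> bool" where
  "hormander_on \<Omega> C \<longleftrightarrow> (\<forall>x\<in>\<Omega>. dim {V x | V. V \<in> Lie C} = CARD('n))"

definition L1_loc :: "(real^'n) set \<Rightarrow> (real^'n \<Rightarrow> 'b::euclidean_space) set" where
  "L1_loc \<Omega> = {f. \<forall>K. compact K \<and> K \<subseteq> \<Omega> \<longrightarrow> set_integrable lebesgue K f}"

definition Linf :: "(real^'n) set \<Rightarrow> (real^'n \<Rightarrow> 'b::euclidean_space) set" where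
  "Linf V = {f. f \<in> borel_measurable (lebesgue_on V) \<and>
                (\<exists>M. AE x in lebesgue_on V. norm (f x) \<le> M)}"

definition Linf_loc :: "(real^'n) set \<Rightarrow> (real^'n \<Rightarrow> 'b::euclidean_space) set" where
  "Linf_loc \<Omega> = {f. \<forall>K. compact K \<and> K \<subseteq> \<Omega> \<longrightarrow> f \<in> Linf K}"

text \<open>Elements of \<open>C_c^\<infinity>(\<Omega>, real^'m)\<close>, extended by zero.\<close>

definition test_functions :: "(real^'n) set \<Rightarrow> (real^'n \<Rightarrow> real^'m) set" where
  "test_functions \<Omega> = {\<phi>. smooth_on UNIV \<phi> \<and>
     compact (closure {x. \<phi> x \<noteq> 0}) \<and> closure {x. \<phi> x \<noteq> 0} \<subseteq> \<Omega>}"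

definition divergence :: "(real^'n \<Rightarrow> real^'n) \<Rightarrow> real^'n \<Rightarrow> real" where
  "divergence F x = trace (jacobian F (at x))"

definition distr_hgrad ::
  "(real^'n) set \<Rightarrow> (real^'n \<Rightarrow> real^'n^'m) \<Rightarrow> (real^'n \<Rightarrow> real) \<Rightarrow> (real^'n \<Rightarrow> real^'m) \<Rightarrow> real" where
  "distr_hgrad \<Omega> C u \<phi> =
     - set_lebesgue_integral lebesgue \<Omega> (\<lambda>x. u x * divergence (\<lambda>y. \<phi> y v* C y) x)"

text \<open>The distribution \<open>Xu\<close> on \<open>\<Omega>\<close> is (represented by) the locally integrable function \<open>g\<close>.\<close>

definition is_hgrad ::
  "(real^'n) set \<Rightarrow> (real^'n \<Rightarrow> real^'n^'m) \<Rightarrow> (real^'n \<Rightarrow> real) \<Rightarrow> (real^'n \<Rightarrow> real^'m) \<Rightarrow> bool" where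
  "is_hgrad \<Omega> C u g \<longleftrightarrow> u \<in> L1_loc \<Omega> \<and> g \<in> L1_loc \<Omega> \<and>
     (\<forall>\<phi>\<in>test_functions \<Omega>.
        distr_hgrad \<Omega> C u \<phi> = set_lebesgue_integral lebesgue \<Omega> (\<lambda>x. g x \<bullet> \<phi> x))"

definition C1_X :: "(real^'n) set \<Rightarrow> (real^'n \<Rightarrow> real^'n^'m) \<Rightarrow> (real^'n \<Rightarrow> real) set" where
  "C1_X \<Omega> C = {u. continuous_on \<Omega> u \<and> (\<exists>g. continuous_on \<Omega> g \<and> is_hgrad \<Omega> C u g)}"

definition W1inf_X_loc :: "(real^'n) set \<Rightarrow> (real^'n \<Rightarrow> real^'n^'m) \<Rightarrow> (real^'n \<Rightarrow> real) set" where
  "W1inf_X_loc \<Omega> C = {u \<in> Linf_loc \<Omega>.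
     \<forall>V. open V \<and> compact (closure V) \<and> closure V \<subseteq> \<Omega> \<longrightarrow>
       u \<in> Linf V \<and> (\<exists>g \<in> Linf V. is_hgrad V C u g)}"

definition quasiconvex :: "('a::real_vector \<Rightarrow> real) \<Rightarrow> bool" where
  "quasiconvex h \<longleftrightarrow>
     (\<forall>\<xi> \<eta>. \<forall>t\<in>{0..1}. h (t *\<^sub>R \<xi> + (1 - t) *\<^sub>R \<eta>) \<le> max (h \<xi>) (h \<eta>))"

definition usc_on :: "'a::topological_space set \<Rightarrow> ('a \<Rightarrow> real) \<Rightarrow> bool" where
  "usc_on S f \<longleftrightarrow> (\<forall>x\<in>S. \<forall>a > f x. eventually (\<lambda>y. f y < a) (at x within S))"

text \<open>
  For \<open>\<phi> \<in> C1_X \<Omega> C\<close> the value \<open>X\<phi>(x\<^sub>0)\<close> is that of the continuous function representing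
  \<open>X\<phi>\<close>, which is unique on the open set \<open>\<Omega>\<close>.
\<close>

definition viscosity_subsolution ::
  "(real^'n) set \<Rightarrow> (real^'n \<Rightarrow> real^'n^'m) \<Rightarrow> (real^'n \<Rightarrow> real \<Rightarrow> real^'m \<Rightarrow> real) \<Rightarrow>
   (real^'n \<Rightarrow> real) \<Rightarrow> bool" where
  "viscosity_subsolution \<Omega> C H u \<longleftrightarrow> usc_on \<Omega> u \<and>
     (\<forall>x0\<in>\<Omega>. \<forall>\<phi>\<in>C1_X \<Omega> C. \<forall>X\<phi>.
        continuous_on \<Omega> X\<phi> \<and> is_hgrad \<Omega> C \<phi> X\<phi> \<and>
        eventually (\<lambda>x. u x0 - \<phi> x0 \<ge> u x - \<phi> x) (nhds x0)
        \<longrightarrow> H x0 (u x0) (X\<phi> x0) \<le> 0)"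

text \<open>
  Elements of \<open>W1inf_X_loc \<Omega> C\<close> are functions up to null sets, and pointwise statements about
  them refer to the continuous representative.
\<close>

definition continuous_representative ::
  "(real^'n) set \<Rightarrow> (real^'n \<Rightarrow> real) \<Rightarrow> (real^'n \<Rightarrow> real) \<Rightarrow> bool" where
  "continuous_representative \<Omega> u v \<longleftrightarrow>
     continuous_on \<Omega> v \<and> (AE x in lebesgue_on \<Omega>. v x = u x)"

end

theory Submission
  imports Defs
begin

text \<open>
  Suppose that \<open>v - \<phi>\<close> has a local maximum at \<open>x0\<close>, where \<open>v\<close> is the continuous representative of \<open>u\<close>,
  but \<open>H x0 (v x0) (X\<phi> x0) > 0\<close>. The gradient \<open>Xu\<close> is bounded near \<open>x0\<close> and satisfies
  \<open>H x (v x) (Xu x) \<le> 0\<close> almost everywhere, so by continuity its values near \<open>x0\<close> lie in a sublevel set of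
  \<open>H x0 (v x0)\<close> that does not contain \<open>X\<phi> x0\<close>. Quasiconvexity makes this sublevel set convex, and a
  hyperplane separates it from \<open>X\<phi> x0\<close> (\<open>separating_direction\<close>). Its normal \<open>\<xi>\<close> selects one field
  \<open>Y = \<xi> v* C\<close>, a constant combination of the given fields, along which the weak derivative of \<open>v - \<phi>\<close>
  near \<open>x0\<close> is at least some \<open>\<epsilon> > 0\<close>. A function that increases along a field cannot have a local maximum.

  As \<open>v - \<phi>\<close> is only continuous and its derivative along \<open>Y\<close> is only distributional, the last sentence is
  the analytic core (\<open>no_local_max_if_weakly_increasing\<close>). It is obtained by mollification. The
  mollified function is differentiable, and Friedrichs' commutator between mollification and \<open>Y\<close> is
  controlled by the oscillation of \<open>v - \<phi>\<close> at the scale of the mollifier (\<open>commutator_estimate\<close>), because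
  \<open>Y\<close> is Lipschitz and because the divergence of a compactly supported field integrates to zero. Hence the
  mollified function still grows along \<open>Y\<close> at a rate of at least \<open>\<epsilon> / 2\<close>. Subtracting a cone of small
  slope centred at \<open>x0\<close> preserves this growth and forces the maximum over a ball onto the sphere, where
  it exceeds the value at the centre by a fixed amount; letting the scale be small contradicts the
  maximality of \<open>v - \<phi>\<close> at \<open>x0\<close>.

  The boundedness of \<open>Xu\<close> rests on the uniqueness of distributional gradients (\<open>hgrad_unique\<close>), which is
  the fundamental lemma of the calculus of variations. Explicit smooth test functions are built from
  \<open>exp (-1/t)\<close>.
\<close>

section \<open>Smooth test functions\<close>

text \<open>
  The functions \<open>exp (-1/t) / t ^ k\<close>, extended by zero to \<open>t \<le> 0\<close>. The whole family is used at
  once because its linear span is closed under differentiation.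
\<close>

definition flat :: "nat \<Rightarrow> real \<Rightarrow> real" where
  "flat k t = (if t > 0 then exp (- 1 / t) / t ^ k else 0)"

lemma flat_nonneg: "0 \<le> flat k t"
  by (simp add: flat_def)

lemma flat_pos: "0 < t \<Longrightarrow> 0 < flat k t"
  by (simp add: flat_def)

lemma flat_nonpos [simp]: "t \<le> 0 \<Longrightarrow> flat k t = 0"
  by (simp add: flat_def)

lemma flat_0_le_1: "flat 0 t \<le> 1"
  by (simp add: flat_def)

text \<open>
  The exponential beats every power: this is the continuity at \<open>0\<close> and, read for \<open>k + 1\<close> as a
  difference quotient of \<open>flat k\<close>, also the differentiability at \<open>0\<close>.
\<close>

lemma flat_tendsto_0: "(flat k \<longlongrightarrow> 0) (at 0)"
proof -
  have "((\<lambda>x::real. x ^ k / exp x) \<longlongrightarrow> 0) at_top"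
    by (rule tendsto_power_div_exp_0)
  then have "((\<lambda>t::real. inverse t ^ k / exp (inverse t)) \<longlongrightarrow> 0) (at_right 0)"
    by (rule filterlim_compose) (rule filterlim_inverse_at_top_right)
  moreover have "eventually (\<lambda>t::real. inverse t ^ k / exp (inverse t) = flat k t) (at_right 0)"
    by (rule eventually_at_right_less[THEN eventually_mono])
       (simp add: flat_def exp_minus field_simps)
  ultimately have "(flat k \<longlongrightarrow> 0) (at_right 0)"
    by (rule Lim_transform_eventually)
  moreover have "eventually (\<lambda>t::real. 0 = flat k t) (at_left 0)"
    by (simp add: eventually_at_filter)
  then have "(flat k \<longlongrightarrow> 0) (at_left 0)"
    by (rule Lim_transform_eventually[OF tendsto_const])
  ultimately show ?thesis
    by (simp add: filterlim_split_at)
qed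

lemma DERIV_flat: "(flat k has_real_derivative flat (k + 2) t - k * flat (k + 1) t) (at t)"
proof (cases t "0::real" rule: linorder_cases)
  case less
  have "((\<lambda>t. 0) has_real_derivative 0) (at t)" by simp
  then have "(flat k has_real_derivative 0) (at t)"
    by (rule has_field_derivative_transform_within_open[of _ _ _ "{..<0}"]) (use less in auto)
  then show ?thesis using less by simp
next
  case equal
  have "((\<lambda>y. (flat k y - flat k 0) / (y - 0)) \<longlongrightarrow> 0) (at 0)"
    by (rule Lim_transform_eventually[OF flat_tendsto_0[of "Suc k"]])
       (auto simp: flat_def eventually_at_filter)
  then show ?thesis using equal by (simp add: has_field_derivative_iff)
next
  case greater
  have "((\<lambda>t. exp (- 1 / t) / t ^ k) has_real_derivative
      (exp (- 1 / t) * (1 / t\<^sup>2) * t ^ k - exp (- 1 / t) * (k * t ^ (k - 1))) / (t ^ k * t ^ k)) (at t)"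
    using greater by (auto intro!: derivative_eq_intros simp: power2_eq_square)
  then have "(flat k has_real_derivative
      (exp (- 1 / t) * (1 / t\<^sup>2) * t ^ k - exp (- 1 / t) * (k * t ^ (k - 1))) / (t ^ k * t ^ k)) (at t)"
    by (rule has_field_derivative_transform_within_open[of _ _ _ "{0<..}"])
       (use greater in \<open>auto simp: flat_def\<close>)
  moreover have "(exp (- 1 / t) * (1 / t\<^sup>2) * t ^ k - exp (- 1 / t) * (k * t ^ (k - 1))) / (t ^ k * t ^ k)
      = flat (k + 2) t - k * flat (k + 1) t"
    using greater by (cases k) (simp_all add: flat_def field_simps power2_eq_square)
  ultimately show ?thesis by simp
qed

text \<open>
  The functions built from linear forms and the functions \<open>flat k\<close> by ring operations and
  composition. All directional derivatives of such a function are again such functions, so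
  smoothness follows by a single induction on the order of differentiation.
\<close>

inductive flat_algebra :: "('a::euclidean_space \<Rightarrow> real) \<Rightarrow> bool" where
  const: "flat_algebra (\<lambda>x. c)"
| inner: "flat_algebra (\<lambda>x. x \<bullet> b)"
| flat: "flat_algebra p \<Longrightarrow> flat_algebra (\<lambda>x. flat k (p x))"
| add: "flat_algebra p \<Longrightarrow> flat_algebra q \<Longrightarrow> flat_algebra (\<lambda>x. p x + q x)"
| mult: "flat_algebra p \<Longrightarrow> flat_algebra q \<Longrightarrow> flat_algebra (\<lambda>x. p x * q x)"

lemma flat_algebra_derivative:
  assumes "flat_algebra f"
  shows "\<exists>f'. (\<forall>x. (f has_derivative f' x) (at x)) \<and> (\<forall>v. flat_algebra (\<lambda>x. f' x v))"
  using assms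
proof induction
  case (const c)
  show ?case by (rule exI[of _ "\<lambda>_ _. 0"]) (auto intro: flat_algebra.const)
next
  case (inner b)
  show ?case by (rule exI[of _ "\<lambda>_ v. v \<bullet> b"])
      (auto intro: flat_algebra.const intro!: derivative_eq_intros)
next
  case (flat p k)
  then obtain p' where p': "\<And>x. (p has_derivative p' x) (at x)" "\<And>v. flat_algebra (\<lambda>x. p' x v)"
    by blast
  show ?case
  proof (intro exI conjI allI)
    fix x
    show "((\<lambda>x. flat k (p x)) has_derivative
        (\<lambda>v. p' x v * (flat (k + 2) (p x) + (- real k) * flat (k + 1) (p x)))) (at x)"
      using DERIV_compose_FDERIV[OF DERIV_flat p'(1), of k] by (simp add: algebra_simps)
  next
    fix v
    show "flat_algebra (\<lambda>x. p' x v * (flat (k + 2) (p x) + (- real k) * flat (k + 1) (p x)))"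
      by (intro flat_algebra.intros p' flat.hyps)
  qed
next
  case (add p q)
  then obtain p' q' where
    "\<And>x. (p has_derivative p' x) (at x)" "\<And>v. flat_algebra (\<lambda>x. p' x v)"
    "\<And>x. (q has_derivative q' x) (at x)" "\<And>v. flat_algebra (\<lambda>x. q' x v)"
    by metis
  then show ?case
    by (intro exI[of _ "\<lambda>x v. p' x v + q' x v"]) (auto intro: flat_algebra.add has_derivative_add)
next
  case (mult p q)
  then obtain p' q' where
    "\<And>x. (p has_derivative p' x) (at x)" "\<And>v. flat_algebra (\<lambda>x. p' x v)"
    "\<And>x. (q has_derivative q' x) (at x)" "\<And>v. flat_algebra (\<lambda>x. q' x v)"
    by metis
  then show ?case
    by (intro exI[of _ "\<lambda>x v. p x * q' x v + p' x v * q x"])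
      (auto intro!: flat_algebra.add flat_algebra.mult \<open>flat_algebra p\<close> \<open>flat_algebra q\<close> has_derivative_mult)
qed

lemma flat_algebra_smooth:
  assumes "flat_algebra f"
  shows "smooth_on S (\<lambda>x. f x *\<^sub>R \<xi>)"
proof -
  have "Ck_on k S (\<lambda>x. f x *\<^sub>R \<xi>)" for k
    using assms
  proof (induction k arbitrary: f)
    case 0
    then obtain f' where "\<And>x. (f has_derivative f' x) (at x)"
      using flat_algebra_derivative by blast
    then have "continuous_on S f"
      by (meson continuous_at_imp_continuous_on has_derivative_continuous)
    then show ?case by (auto intro!: continuous_intros)
  next
    case (Suc k)
    then obtain f' where f': "\<And>x. (f has_derivative f' x) (at x)" "\<And>v. flat_algebra (\<lambda>x. f' x v)"
      using flat_algebra_derivative by blast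
    have *: "((\<lambda>x. f x *\<^sub>R \<xi>) has_derivative (\<lambda>v. f' x v *\<^sub>R \<xi>)) (at x)" for x
      by (auto intro!: derivative_eq_intros f')
    have **: "frechet_derivative (\<lambda>x. f x *\<^sub>R \<xi>) (at x) = (\<lambda>v. f' x v *\<^sub>R \<xi>)" for x
      using frechet_derivative_at[OF *] by simp
    show ?case
      using * Suc.IH[OF f'(2)] by (auto simp: ** differentiable_def)
  qed
  then show ?thesis by (simp add: smooth_on_def)
qed

lemma flat_algebra_prod:
  assumes "finite A" "\<And>i. i \<in> A \<Longrightarrow> flat_algebra (f i)"
  shows "flat_algebra (\<lambda>x. \<Prod>i\<in>A. f i x)"
  using assms by (induction A) (auto intro: flat_algebra.intros)

lemma flat_algebra_continuous: "flat_algebra f \<Longrightarrow> continuous_on S f"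
  using flat_algebra_smooth[of f S "1::real"] unfolding smooth_on_def
  by (metis (no_types, lifting) ext Ck_on.simps(1) mult.right_neutral real_scaleR_def)

text \<open>
  The radial mollifier at scale \<open>\<eta>\<close> centred at \<open>y\<close>. It is left unnormalised, so that its derivative stays
  a plain expression in \<open>flat 2\<close>; its mass appears as a factor in all estimates instead.
\<close>

definition bump :: "real \<Rightarrow> 'a::euclidean_space \<Rightarrow> 'a \<Rightarrow> real" where
  "bump \<eta> y x = flat 0 (\<eta>\<^sup>2 - (norm (x - y))\<^sup>2)"

definition bump_deriv :: "real \<Rightarrow> 'a::euclidean_space \<Rightarrow> 'a \<Rightarrow> 'a \<Rightarrow> real" where
  "bump_deriv \<eta> y x h = - 2 * ((x - y) \<bullet> h) * flat 2 (\<eta>\<^sup>2 - (norm (x - y))\<^sup>2)"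

lemma bump_nonneg: "0 \<le> bump \<eta> y x"
  by (simp add: bump_def flat_nonneg)

lemma bump_outside: "0 < \<eta> \<Longrightarrow> x \<notin> ball y \<eta> \<Longrightarrow> bump \<eta> y x = 0"
  by (auto simp: bump_def dist_norm norm_minus_commute intro!: flat_nonpos power_mono)

lemma bump_deriv_outside: "0 < \<eta> \<Longrightarrow> x \<notin> ball y \<eta> \<Longrightarrow> bump_deriv \<eta> y x h = 0"
  by (auto simp: bump_deriv_def dist_norm norm_minus_commute intro!: flat_nonpos power_mono)

lemma bump_pos: "x \<in> ball y \<eta> \<Longrightarrow> 0 < bump \<eta> y x"
  by (auto simp: bump_def dist_norm norm_minus_commute intro!: flat_pos power_strict_mono)

lemma has_derivative_bump: "(bump \<eta> y has_derivative bump_deriv \<eta> y x) (at x)"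
proof -
  have "((\<lambda>x. \<eta>\<^sup>2 - (x - y) \<bullet> (x - y)) has_derivative (\<lambda>h. - 2 * ((x - y) \<bullet> h))) (at x)"
    by (auto intro!: derivative_eq_intros simp: inner_commute)
  from DERIV_compose_FDERIV[OF DERIV_flat this, of 0] show ?thesis
    by (simp add: bump_def[abs_def] bump_deriv_def[abs_def] dot_square_norm numeral_2_eq_2)
qed

lemma flat_algebra_bump: "flat_algebra (bump \<eta> y)"
proof -
  have 1: "flat_algebra (\<lambda>x. (x - y) \<bullet> b)" for b
    using flat_algebra.add[OF flat_algebra.inner flat_algebra.const, of b "- (y \<bullet> b)"]
    by (simp add: inner_diff_left)
  have 2: "flat_algebra (\<lambda>x. \<Sum>b\<in>A. ((x - y) \<bullet> b) * ((x - y) \<bullet> b))" if "finite A" for A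
    using that by (induction A) (auto intro!: flat_algebra.intros 1)
  have "flat_algebra (\<lambda>x. flat 0 (\<eta>\<^sup>2 + (- 1) * (\<Sum>b\<in>Basis. ((x - y) \<bullet> b) * ((x - y) \<bullet> b))))"
    by (intro flat_algebra.intros 2) simp
  then show ?thesis
    by (simp add: bump_def[abs_def] flip: euclidean_inner power2_norm_eq_inner)
qed

lemma continuous_on_flat [continuous_intros]:
  "continuous_on S f \<Longrightarrow> continuous_on S (\<lambda>x. flat k (f x))"
  by (rule continuous_on_compose2[of UNIV "flat k"])
     (auto intro!: DERIV_continuous_on DERIV_subset[OF DERIV_flat])

lemma continuous_on_bump [continuous_intros]:
  "continuous_on S f \<Longrightarrow> continuous_on S g \<Longrightarrow> continuous_on S (\<lambda>x. bump \<eta> (f x) (g x))"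
  unfolding bump_def by (intro continuous_intros)

lemma continuous_on_bump_deriv [continuous_intros]:
  "continuous_on S f \<Longrightarrow> continuous_on S g \<Longrightarrow> continuous_on S h \<Longrightarrow>
    continuous_on S (\<lambda>x. bump_deriv \<eta> (f x) (g x) (h x))"
  unfolding bump_deriv_def by (intro continuous_intros)

lemma test_functionsI:
  fixes \<xi> :: "real^'m" and f :: "real^'n \<Rightarrow> real"
  assumes "flat_algebra f" "compact K" "K \<subseteq> \<Omega>" "\<And>x. x \<notin> K \<Longrightarrow> f x = 0"
  shows "(\<lambda>x. f x *\<^sub>R \<xi>) \<in> test_functions \<Omega>"
proof -
  have "closure {x. f x *\<^sub>R \<xi> \<noteq> 0} \<subseteq> K"
    using assms by (intro closure_minimal compact_imp_closed) auto
  moreover have "compact (closure {x. f x *\<^sub>R \<xi> \<noteq> 0})"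
    using calculation assms(2) by (meson bounded_subset closed_closure compact_eq_bounded_closed)
  ultimately show ?thesis
    using assms flat_algebra_smooth by (auto simp: test_functions_def)
qed

section \<open>Divergence theorem\<close>

lemma integral_eq_integral_UNIV:
  fixes f :: "'a::euclidean_space \<Rightarrow> 'b::banach"
  assumes "\<And>x. x \<notin> S \<Longrightarrow> f x = 0"
  shows "integral S f = integral UNIV f"
proof -
  have "integral UNIV (\<lambda>x. if x \<in> S then f x else 0) = integral UNIV f"
    by (rule arg_cong[where f = "integral UNIV"]) (use assms in auto)
  then show ?thesis by (simp only: integral_restrict_UNIV)
qed

text \<open>
  The integral of the translate \<open>\<lambda>x. F (x + t *\<^sub>R e)\<close> does not depend on \<open>t\<close>; differentiating it under
  the integral sign at \<open>t = 0\<close> gives the integral of \<open>F'\<close> in direction \<open>e\<close>.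
\<close>

lemma integral_directional_derivative_eq_0:
  fixes F :: "'a::euclidean_space \<Rightarrow> real"
  assumes "bounded K" and zero: "\<And>x. x \<notin> K \<Longrightarrow> F x = 0"
    and F': "\<And>x. (F has_derivative F' x) (at x)"
    and cont: "continuous_on UNIV (\<lambda>x. F' x e)"
  shows "((\<lambda>x. F' x e) has_integral 0) UNIV"
proof -
  obtain B where B: "\<And>x. x \<in> K \<Longrightarrow> norm x \<le> B"
    using \<open>bounded K\<close> by (auto simp: bounded_iff)
  have "bounded (cball (0::'a) (B + norm e))" by simp
  then obtain a b :: 'a where Q: "cball 0 (B + norm e) \<subseteq> cbox a b"
    using bounded_subset_cbox_symmetric by blast
  have KQ: "x + t *\<^sub>R e \<notin> K" if "\<bar>t\<bar> \<le> 1" "x \<notin> cbox a b" for x t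
  proof
    assume "x + t *\<^sub>R e \<in> K"
    then have "norm (x + t *\<^sub>R e) \<le> B" by (rule B)
    moreover have "norm x \<le> norm (x + t *\<^sub>R e) + norm (t *\<^sub>R e)"
      using norm_triangle_ineq4[of "x + t *\<^sub>R e" "t *\<^sub>R e"] by simp
    moreover have "norm (t *\<^sub>R e) \<le> norm e"
      using that(1) by (simp add: mult_left_le_one_le)
    ultimately have "x \<in> cball 0 (B + norm e)" by simp
    then show False using Q that(2) by blast
  qed
  have contF: "continuous_on S F" for S
    using has_derivative_continuous[OF F'] by (intro continuous_at_imp_continuous_on) simp
  have const: "integral (cbox a b) (\<lambda>x. F (x + t *\<^sub>R e)) = integral (cbox a b) F"
    if t: "t \<in> {-1..1}" for t
  proof -
    have "integral (cbox a b) (\<lambda>x. F (x + t *\<^sub>R e)) = integral UNIV (\<lambda>x. F (x + t *\<^sub>R e))"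
    proof (rule integral_eq_integral_UNIV)
      show "F (x + t *\<^sub>R e) = 0" if "x \<notin> cbox a b" for x
        using KQ[of t x] t zero that by (simp add: abs_le_iff)
    qed
    also have "\<dots> = integral (cbox (a - t *\<^sub>R e) (b - t *\<^sub>R e)) (\<lambda>x. F (x + t *\<^sub>R e))"
    proof (rule integral_eq_integral_UNIV[symmetric])
      fix x assume "x \<notin> cbox (a - t *\<^sub>R e) (b - t *\<^sub>R e)"
      then have "x + t *\<^sub>R e \<notin> cbox a b"
        by (auto simp: mem_box algebra_simps)
      then show "F (x + t *\<^sub>R e) = 0"
        using KQ[of 0] zero by simp
    qed
    also have "\<dots> = integral (cbox a b) F"
      by (rule integral_shift_cbox)
    finally show ?thesis .
  qed
  have "((\<lambda>t. integral (cbox a b) (\<lambda>x. F (x + t *\<^sub>R e))) has_field_derivative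
        integral (cbox a b) (\<lambda>x. F' (x + 0 *\<^sub>R e) e)) (at 0 within {-1..1})"
  proof (rule leibniz_rule_field_derivative)
    fix t x
    have "((\<lambda>t. x + t *\<^sub>R e) has_derivative (\<lambda>h. h *\<^sub>R e)) (at t within {-1..1})"
      using has_derivative_add[OF has_derivative_const
        bounded_linear_imp_has_derivative[OF bounded_linear_scaleR_left], of x] by simp
    from has_derivative_compose[OF this F'] have
      "((\<lambda>t. F (x + t *\<^sub>R e)) has_derivative (\<lambda>h. F' (x + t *\<^sub>R e) (h *\<^sub>R e))) (at t within {-1..1})" .
    moreover have "F' (x + t *\<^sub>R e) (h *\<^sub>R e) = F' (x + t *\<^sub>R e) e * h" for h
      using linear_simps(5)[OF has_derivative_bounded_linear[OF F']] by simp
    ultimately show "((\<lambda>t. F (x + t *\<^sub>R e)) has_field_derivative F' (x + t *\<^sub>R e) e) (at t within {-1..1})"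
      by (simp add: has_field_derivative_def)
  next
    fix t :: real
    have "continuous_on (cbox a b) (\<lambda>x. F (x + t *\<^sub>R e))"
      by (rule continuous_on_compose2[OF contF[of UNIV]]) (auto intro!: continuous_intros)
    then show "(\<lambda>x. F (x + t *\<^sub>R e)) integrable_on cbox a b"
      by (rule integrable_continuous)
  next
    show "continuous_on ({-1..1} \<times> cbox a b) (\<lambda>(t, x). F' (x + t *\<^sub>R e) e)"
      unfolding split_beta
      by (rule continuous_on_compose2[OF cont]) (auto intro!: continuous_intros)
  qed auto
  then have leib: "((\<lambda>t. integral (cbox a b) (\<lambda>x. F (x + t *\<^sub>R e))) has_field_derivative
        integral (cbox a b) (\<lambda>x. F' x e)) (at 0 within {-1..1})"
    by (simp only: scaleR_zero_left add_0_right)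
  have "((\<lambda>t. integral (cbox a b) F) has_field_derivative integral (cbox a b) (\<lambda>x. F' x e))
      (at 0 within {-1..1})"
    using const by (intro has_field_derivative_transform_within[OF leib zero_less_one]) simp_all
  then have "((\<lambda>t. integral (cbox a b) F) has_vector_derivative integral (cbox a b) (\<lambda>x. F' x e))
      (at 0 within cbox (-1) 1)"
    by (simp add: has_real_derivative_iff_has_vector_derivative)
  from vector_derivative_unique_within_closed_interval[OF _ _ this has_vector_derivative_const]
  have *: "integral (cbox a b) (\<lambda>x. F' x e) = 0" by simp
  have "continuous_on (cbox a b) (\<lambda>x. F' x e)"
    using cont by (rule continuous_on_subset) simp
  from integrable_integral[OF integrable_continuous[OF this]]
  have "((\<lambda>x. F' x e) has_integral 0) (cbox a b)"
    by (simp only: *)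
  then show ?thesis
  proof (rule has_integral_on_superset)
    fix x assume x: "x \<notin> cbox a b"
    have "(F has_derivative (\<lambda>_. 0)) (at x)"
    proof (rule has_derivative_transform_within_open)
      show "((\<lambda>_. 0) has_derivative (\<lambda>_. 0)) (at x)" by simp
      show "open (- cbox a b)" by (simp add: open_Compl closed_cbox)
      show "0 = F y" if "y \<in> - cbox a b" for y using that KQ[of 0 y] zero by simp
    qed (use x in auto)
    then have "F' x = (\<lambda>_. 0)" by (rule has_derivative_unique[OF F'])
    then show "F' x e = 0" by simp
  qed simp
qed

text \<open>
  Each diagonal entry of the Jacobian is a directional derivative of a compactly supported function.
\<close>

lemma integral_divergence_eq_0:
  fixes G :: "real^'n \<Rightarrow> real^'n"
  assumes "bounded K" "\<And>x. x \<notin> K \<Longrightarrow> G x = 0"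
    and G': "\<And>x. (G has_derivative G' x) (at x)"
    and cont: "\<And>e. continuous_on UNIV (\<lambda>x. G' x e)"
  shows "((\<lambda>x. trace (matrix (G' x))) has_integral 0) UNIV"
proof -
  have "((\<lambda>x. G' x (axis i 1) $ i) has_integral 0) UNIV" for i
  proof (rule integral_directional_derivative_eq_0[of K "\<lambda>x. G x $ i" "\<lambda>x h. G' x h $ i"])
    show "bounded K" by fact
    show "G x $ i = 0" if "x \<notin> K" for x
      using assms(2)[OF that] by simp
    show "((\<lambda>x. G x $ i) has_derivative (\<lambda>h. G' x h $ i)) (at x)" for x
      using G' by (rule bounded_linear.has_derivative[OF bounded_linear_vec_nth])
    show "continuous_on UNIV (\<lambda>x. G' x (axis i 1) $ i)"
      using cont by (rule continuous_on_component)
  qed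
  from has_integral_sum[OF finite this] show ?thesis
    by (simp add: trace_def matrix_def)
qed

section \<open>The fundamental lemma of the calculus of variations\<close>

text \<open>
  For \<open>k\<close> tending to infinity these functions increase to the indicator of the open box, because
  \<open>flat 0 (k * s)\<close> tends to \<open>1\<close> for \<open>s > 0\<close> and vanishes for \<open>s \<le> 0\<close>. They turn integrals against test
  functions into integrals over boxes.
\<close>

definition box_bump :: "real \<Rightarrow> 'a::euclidean_space \<Rightarrow> 'a \<Rightarrow> 'a \<Rightarrow> real" where
  "box_bump k a b x = (\<Prod>i\<in>Basis. flat 0 (k * (x \<bullet> i - a \<bullet> i)) * flat 0 (k * (b \<bullet> i - x \<bullet> i)))"

lemma flat_algebra_box_bump: "flat_algebra (box_bump k a b)"
proof -
  have "flat_algebra (\<lambda>x. \<Prod>i\<in>Basis. flat 0 (k * (x \<bullet> i + - (a \<bullet> i))) * flat 0 (k * (b \<bullet> i + (-1) * (x \<bullet> i))))"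
    by (intro flat_algebra_prod flat_algebra.intros) auto
  then show ?thesis by (simp add: box_bump_def[abs_def])
qed

lemma box_bump_bounds: "0 \<le> box_bump k a b x" "box_bump k a b x \<le> 1"
  by (auto simp: box_bump_def intro!: prod_nonneg prod_le_1 mult_nonneg_nonneg mult_le_one flat_nonneg flat_0_le_1)

lemma box_bump_outside:
  assumes "0 \<le> k" "x \<notin> box a b"
  shows "box_bump k a b x = 0"
proof -
  obtain i where i: "i \<in> Basis" "x \<bullet> i \<le> a \<bullet> i \<or> b \<bullet> i \<le> x \<bullet> i"
    using assms(2) by (auto simp: mem_box not_less)
  then have "k * (x \<bullet> i - a \<bullet> i) \<le> 0 \<or> k * (b \<bullet> i - x \<bullet> i) \<le> 0"
    using assms(1) by (auto intro: mult_nonneg_nonpos)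
  then show ?thesis
    unfolding box_bump_def using i(1) by (intro prod_zero bexI[of _ i]) auto
qed

lemma flat_0_scaled_tendsto_1:
  assumes "0 < s"
  shows "(\<lambda>n. flat 0 (real (Suc n) * s)) \<longlonglongrightarrow> 1"
proof -
  have "(\<lambda>n. exp (- ((1 / s) * inverse (real (Suc n))))) \<longlonglongrightarrow> exp (- ((1 / s) * 0))"
    by (intro tendsto_intros LIMSEQ_inverse_real_of_nat)
  moreover have "exp (- ((1 / s) * inverse (real (Suc n)))) = flat 0 (real (Suc n) * s)" for n
    using assms by (simp add: flat_def inverse_eq_divide mult.commute del: of_nat_Suc)
  ultimately show ?thesis by simp
qed

lemma box_bump_tendsto: "(\<lambda>n. box_bump (real (Suc n)) a b x) \<longlonglongrightarrow> indicator (box a b) x"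
proof (cases "x \<in> box a b")
  case True
  then have "(\<lambda>n. box_bump (real (Suc n)) a b x) \<longlonglongrightarrow> (\<Prod>i\<in>(Basis::'a set). 1 * 1)"
    unfolding box_bump_def
    by (intro tendsto_prod tendsto_mult flat_0_scaled_tendsto_1) (auto simp: mem_box)
  then show ?thesis using True by simp
next
  case False
  have "box_bump (real (Suc n)) a b x = 0" for n
    by (rule box_bump_outside) (use False in auto)
  then show ?thesis using False by simp
qed

text \<open>
  By dominated convergence along the box bumps, \<open>f\<close> has integral zero over every box in the ball,
  and by Lebesgue's differentiation theorem for cubes the averages of \<open>f\<close> over small cubes at \<open>x\<close> tend
  to \<open>f x\<close> for almost every \<open>x\<close>.
\<close>

lemma AE_zero_if_orthogonal_to_test_functions:
  fixes f :: "'a::euclidean_space \<Rightarrow> real"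
  assumes f: "set_integrable lebesgue (cball x0 R) f"
    and orth: "\<And>\<psi> K. \<lbrakk>flat_algebra \<psi>; compact K; K \<subseteq> ball x0 R; \<And>x. x \<notin> K \<Longrightarrow> \<psi> x = 0\<rbrakk>
      \<Longrightarrow> (LINT x:cball x0 R|lebesgue. f x * \<psi> x) = 0"
  shows "AE x in lebesgue. x \<in> ball x0 R \<longrightarrow> f x = 0"
proof -
  define F where "F x = indicator (cball x0 R) x * f x" for x
  have F: "integrable lebesgue F"
    using f by (simp add: set_integrable_def F_def[abs_def])
  have box: "integral (cbox a b) F = 0" if ab: "cbox a b \<subseteq> ball x0 R" for a b
  proof -
    have zero: "(\<integral>x. F x * box_bump (real (Suc n)) a b x \<partial>lebesgue) = 0" for n
      using orth[OF flat_algebra_box_bump compact_cbox ab, of "real (Suc n)" a b]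
        box_bump_outside[of "real (Suc n)" _ a b] box_subset_cbox[of a b]
      by (auto simp: set_lebesgue_integral_def F_def mult.assoc)
    have meas: "box_bump k a b \<in> borel_measurable lebesgue" for k
      using borel_measurable_continuous_onI[OF flat_algebra_continuous[OF flat_algebra_box_bump]]
      by (intro measurable_completion) simp
    have "(\<lambda>n. \<integral>x. F x * box_bump (real (Suc n)) a b x \<partial>lebesgue) \<longlonglongrightarrow>
        (\<integral>x. F x * indicator (box a b) x \<partial>lebesgue)"
    proof (rule integral_dominated_convergence)
      show "integrable lebesgue (\<lambda>x. norm (F x))" using F by simp
      show "AE x in lebesgue. (\<lambda>n. F x * box_bump (real (Suc n)) a b x) \<longlonglongrightarrow> F x * indicator (box a b) x"
        by (intro AE_I2 tendsto_mult tendsto_const box_bump_tendsto)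
      show "AE x in lebesgue. norm (F x * box_bump (real (Suc n)) a b x) \<le> norm (F x)" for n
        by (intro AE_I2) (simp add: abs_mult box_bump_bounds mult_left_le)
      show "(\<lambda>x. F x * box_bump (real (Suc n)) a b x) \<in> borel_measurable lebesgue" for n
        using F meas by (intro borel_measurable_times) auto
      show "(\<lambda>x. F x * indicator (box a b) x) \<in> borel_measurable lebesgue"
        using F by (intro borel_measurable_times borel_measurable_indicator) auto
    qed
    then have "(\<integral>x. F x * indicator (box a b) x \<partial>lebesgue) = 0"
      using LIMSEQ_unique tendsto_const unfolding zero by blast
    moreover have "set_integrable lebesgue (box a b) F"
      unfolding set_integrable_def using F by (intro integrable_mult_indicator) auto
    ultimately have "integral (box a b) F = 0"
      using set_lebesgue_integral_eq_integral(2)[of "box a b" F]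
      by (simp add: set_lebesgue_integral_def mult.commute)
    then show ?thesis by (simp add: integral_open_interval)
  qed
  have "F integrable_on UNIV"
    using F by (simp add: integrable_on_lebesgue)
  then have "F integrable_on cbox a b" for a b
    by (rule integrable_on_subcbox) simp
  then obtain N where N: "negligible N" and lim: "\<And>x e. \<lbrakk>x \<notin> N; 0 < e\<rbrakk> \<Longrightarrow>
      \<exists>d>0. \<forall>h. 0 < h \<and> h < d \<longrightarrow>
        norm (integral (cbox x (x + h *\<^sub>R One)) F /\<^sub>R h ^ DIM('a) - F x) < e"
    using integrable_ccontinuous_explicit by blast
  have "f x = 0" if xN: "x \<notin> N" and xR: "x \<in> ball x0 R" for x
  proof -
    obtain r where r: "r > 0" "cball x r \<subseteq> ball x0 R"
      using xR open_contains_cball open_ball by blast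
    have "norm (F x) \<le> 0 + e" if "0 < e" for e
    proof -
      obtain d where d: "d > 0" "\<And>h. 0 < h \<Longrightarrow> h < d \<Longrightarrow>
          norm (integral (cbox x (x + h *\<^sub>R One)) F /\<^sub>R h ^ DIM('a) - F x) < e"
        using lim[OF xN \<open>0 < e\<close>] by blast
      define h where "h = min (d / 2) (r / DIM('a))"
      have h: "0 < h" "h < d" "DIM('a) * h \<le> r"
        using d(1) r(1) by (auto simp: h_def min_def field_simps)
      have "cbox x (x + h *\<^sub>R One) \<subseteq> cball x r"
      proof
        fix y assume y: "y \<in> cbox x (x + h *\<^sub>R One)"
        have "norm (y - x) \<le> (\<Sum>i\<in>Basis. \<bar>(y - x) \<bullet> i\<bar>)"
          by (rule norm_le_l1)
        also have "\<dots> \<le> (\<Sum>i\<in>(Basis::'a set). h)"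
          using y by (intro sum_mono) (auto simp: mem_box inner_diff_left inner_add_left)
        also have "\<dots> \<le> r" using h(3) by simp
        finally show "y \<in> cball x r" by (simp add: dist_norm norm_minus_commute)
      qed
      then have "integral (cbox x (x + h *\<^sub>R One)) F = 0"
        using r(2) by (intro box) blast
      then show ?thesis using d(2)[OF h(1,2)] by simp
    qed
    then have "norm (F x) \<le> 0" by (rule field_le_epsilon)
    then show ?thesis using xR by (simp add: F_def indicator_def)
  qed
  moreover have "AE x in lebesgue. x \<notin> N"
    using N by (intro AE_not_in) (simp add: negligible_iff_null_sets)
  ultimately show ?thesis by (auto elim: eventually_mono)
qed

section \<open>Mollification along a vector field\<close>

text \<open>
  The product rule \<open>div (\<psi> V) = d\<psi>(V) + \<psi> div V\<close> at the level of derivatives.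
\<close>

lemma trace_matrix_sum:
  fixes \<phi> :: "real^'n \<Rightarrow> real" and v :: "real^'n"
  assumes "linear \<phi>"
  shows "trace (matrix (\<lambda>h. \<phi> h *\<^sub>R v + c *\<^sub>R A h)) = \<phi> v + c * trace (matrix A)"
proof -
  have "\<phi> v = \<phi> (\<Sum>i\<in>UNIV. v $ i *\<^sub>R axis i 1)"
    using basis_expansion[of v] by (simp add: scalar_mult_eq_scaleR)
  also have "\<dots> = (\<Sum>i\<in>UNIV. v $ i * \<phi> (axis i 1))"
    by (simp add: linear_sum[OF assms] linear_scale[OF assms])
  finally show ?thesis
    by (simp add: trace_def matrix_def sum.distrib sum_distrib_left mult.commute)
qed

lemma linear_bump_deriv: "linear (bump_deriv \<eta> y x)"
  by (rule has_derivative_linear[OF has_derivative_bump])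

lemma bump_commute: "bump \<eta> y x = bump \<eta> x y"
  by (simp add: bump_def norm_minus_commute)

lemma bump_deriv_commute: "bump_deriv \<eta> y x h = - bump_deriv \<eta> x y h"
  by (simp add: bump_deriv_def norm_minus_commute inner_diff_left algebra_simps)

text \<open>
  By translation invariance the integral of \<open>bump \<eta> y\<close> does not depend on the centre \<open>y\<close>.
\<close>

definition bump_mass :: "'a::euclidean_space itself \<Rightarrow> real \<Rightarrow> real" where
  "bump_mass _ \<eta> = integral UNIV (bump \<eta> (0::'a))"

lemma integral_bump:
  fixes y :: "'a::euclidean_space"
  assumes "0 < \<eta>" "ball y \<eta> \<subseteq> cbox a b"
  shows "integral (cbox a b) (bump \<eta> y) = bump_mass TYPE('a) \<eta>"
proof -
  have "bump \<eta> 0 x = 0" if "x \<notin> cbox (a - y) (b - y)" for x :: 'a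
  proof (rule bump_outside[OF assms(1)])
    show "x \<notin> ball 0 \<eta>"
    proof
      assume "x \<in> ball 0 \<eta>"
      then have "x + y \<in> ball y \<eta>" by (simp add: dist_norm)
      then have "x + y \<in> cbox a b" using assms(2) by blast
      then show False using that by (simp add: mem_box algebra_simps)
    qed
  qed
  then have "bump_mass TYPE('a) \<eta> = integral (cbox (a - y) (b - y)) (bump \<eta> 0)"
    unfolding bump_mass_def by (rule integral_eq_integral_UNIV[symmetric])
  also have "\<dots> = integral (cbox (a - y) (b - y)) (\<lambda>x. bump \<eta> y (x + y))"
    by (simp add: bump_def[abs_def])
  also have "\<dots> = integral (cbox a b) (bump \<eta> y)"
    by (rule integral_shift_cbox)
  finally show ?thesis by simp
qed

lemma bump_mass_pos:
  assumes "0 < \<eta>"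
  shows "0 < bump_mass TYPE('a::euclidean_space) \<eta>"
proof -
  have "bounded (ball (0::'a) \<eta>)" by simp
  then obtain c :: 'a where c: "ball 0 \<eta> \<subseteq> cbox (-c) c"
    using bounded_subset_cbox_symmetric by blast
  have 0: "(0::'a) \<in> ball 0 \<eta>" using assms by simp
  have "ball 0 \<eta> \<subseteq> interior (cbox (-c) c)"
    using c by (intro interior_maximal) auto
  then have box: "0 \<in> box (-c) c" using 0 by (auto simp: interior_cbox)
  have cont: "continuous_on (cbox (-c) c) (bump \<eta> 0)"
    by (intro continuous_intros)
  have "integral (cbox (-c) c) (bump \<eta> 0) \<noteq> 0"
  proof
    assume "integral (cbox (-c) c) (bump \<eta> 0) = 0"
    then have "(bump \<eta> 0 has_integral 0) (cbox (-c) c)"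
      using integrable_integral[OF integrable_continuous[OF cont]] by simp
    then have "bump \<eta> 0 (0::'a) = 0"
      using box box_subset_cbox[of "-c" c]
      by (intro has_integral_0_cbox_imp_0[OF cont]) (auto simp: bump_nonneg)
    then show False using bump_pos[OF 0] by simp
  qed
  moreover have "0 \<le> integral (cbox (-c) c) (bump \<eta> 0)"
    by (rule integral_nonneg[OF integrable_continuous[OF cont]]) (rule bump_nonneg)
  ultimately show ?thesis using integral_bump[OF assms c] by simp
qed

text \<open>
  The divergence theorem for the field \<open>bump \<eta> y x *\<^sub>R (x - y)\<close>, whose divergence is the radial derivative
  of the bump plus \<open>n\<close> times the bump. Since the bump decreases radially, this computes the integral
  of \<open>norm (x - y)\<close> times the norm of its gradient exactly, as \<open>n\<close> times its mass. The constant in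
  the commutator estimate is independent of \<open>\<eta>\<close> for this reason.
\<close>

lemma integral_bump_deriv_radial:
  fixes y :: "real^'n"
  assumes "0 < \<eta>" "ball y \<eta> \<subseteq> cbox a b"
  shows "integral (cbox a b) (\<lambda>x. bump_deriv \<eta> y x (x - y))
      = - (CARD('n) * bump_mass TYPE(real^'n) \<eta>)"
proof -
  have "((\<lambda>x. trace (matrix (\<lambda>h. bump_deriv \<eta> y x h *\<^sub>R (x - y) + bump \<eta> y x *\<^sub>R h))) has_integral 0) UNIV"
  proof (rule integral_divergence_eq_0[of "ball y \<eta>"])
    show "((\<lambda>x. bump \<eta> y x *\<^sub>R (x - y)) has_derivative
        (\<lambda>h. bump_deriv \<eta> y x h *\<^sub>R (x - y) + bump \<eta> y x *\<^sub>R h)) (at x)" for x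
      by (auto intro!: derivative_eq_intros has_derivative_bump)
    show "continuous_on UNIV (\<lambda>x. bump_deriv \<eta> y x e *\<^sub>R (x - y) + bump \<eta> y x *\<^sub>R e)" for e
      by (intro continuous_intros)
  qed (use assms in \<open>auto simp: bump_outside\<close>)
  moreover have "trace (matrix (\<lambda>h::real^'n. h)) = CARD('n)"
    by (simp add: trace_def matrix_def axis_def)
  ultimately have "((\<lambda>x. bump_deriv \<eta> y x (x - y) + bump \<eta> y x * CARD('n)) has_integral 0) UNIV"
    by (simp add: trace_matrix_sum[OF linear_bump_deriv])
  then have "integral UNIV (\<lambda>x. bump_deriv \<eta> y x (x - y) + bump \<eta> y x * CARD('n)) = 0"
    by (rule integral_unique)
  then have "integral (cbox a b) (\<lambda>x. bump_deriv \<eta> y x (x - y) + bump \<eta> y x * CARD('n)) = 0"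
  proof (subst integral_eq_integral_UNIV)
    fix x assume "x \<notin> cbox a b"
    then have "x \<notin> ball y \<eta>" using assms(2) by blast
    then show "bump_deriv \<eta> y x (x - y) + bump \<eta> y x * CARD('n) = 0"
      by (simp add: bump_outside[OF assms(1)] bump_deriv_outside[OF assms(1)] del: mem_ball)
  qed simp
  also have "integral (cbox a b) (\<lambda>x. bump_deriv \<eta> y x (x - y) + bump \<eta> y x * CARD('n))
      = integral (cbox a b) (\<lambda>x. bump_deriv \<eta> y x (x - y)) + integral (cbox a b) (bump \<eta> y) * CARD('n)"
    by (subst Henstock_Kurzweil_Integration.integral_add)
      (auto intro!: integrable_continuous continuous_intros)
  finally show ?thesis by (simp add: integral_bump[OF assms] eq_neg_iff_add_eq_0 mult.commute)
qed

text \<open>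
  The gradient of the bump is a nonpositive multiple of \<open>x - y\<close>, so the worst direction is the radial one.
\<close>

lemma bump_deriv_radial_bound:
  assumes "norm h \<le> L * norm (x - y)"
  shows "\<bar>bump_deriv \<eta> y x h\<bar> \<le> L * (- bump_deriv \<eta> y x (x - y))"
proof -
  let ?k = "2 * flat 2 (\<eta>\<^sup>2 - (norm (x - y))\<^sup>2)"
  have "\<bar>bump_deriv \<eta> y x h\<bar> = ?k * \<bar>(x - y) \<bullet> h\<bar>"
    by (simp add: bump_deriv_def abs_mult flat_nonneg)
  also have "\<dots> \<le> ?k * (norm (x - y) * (L * norm (x - y)))"
    using assms order_trans[OF Cauchy_Schwarz_ineq2 mult_left_mono]
    by (intro mult_left_mono) (auto simp: flat_nonneg)
  also have "\<dots> = L * (- bump_deriv \<eta> y x (x - y))"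
    by (simp add: bump_deriv_def dot_square_norm power2_eq_square)
  finally show ?thesis .
qed

text \<open>
  In the mollification \<open>w\<close> is merely continuous, so that the derivative has to fall on the bump; moving
  the centre of the bump in direction \<open>e\<close> is moving its argument in direction \<open>-e\<close>.
\<close>

lemma mollification_directional_derivative:
  fixes w :: "'a::euclidean_space \<Rightarrow> real"
  assumes w: "continuous_on (cbox a b) w"
  shows "((\<lambda>t. integral (cbox a b) (\<lambda>x. w x * bump \<eta> (y + t *\<^sub>R e) x)) has_real_derivative
      - integral (cbox a b) (\<lambda>x. w x * bump_deriv \<eta> y x e)) (at 0 within {-1..1})"
proof -
  have "((\<lambda>t. integral (cbox a b) (\<lambda>x. w x * bump \<eta> (y + t *\<^sub>R e) x)) has_field_derivative
      integral (cbox a b) (\<lambda>x. w x * - bump_deriv \<eta> (y + 0 *\<^sub>R e) x e)) (at 0 within {-1..1})"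
  proof (rule leibniz_rule_field_derivative)
    fix t x
    have "((\<lambda>t. y + t *\<^sub>R e) has_derivative (\<lambda>h. h *\<^sub>R e)) (at t within {-1..1})"
      using has_derivative_add[OF has_derivative_const
        bounded_linear_imp_has_derivative[OF bounded_linear_scaleR_left], of y] by simp
    from has_derivative_compose[OF this has_derivative_bump] have
      "((\<lambda>t. bump \<eta> x (y + t *\<^sub>R e)) has_derivative
        (\<lambda>h. bump_deriv \<eta> x (y + t *\<^sub>R e) (h *\<^sub>R e))) (at t within {-1..1})" .
    moreover have "(\<lambda>h. bump_deriv \<eta> x (y + t *\<^sub>R e) (h *\<^sub>R e)) = (*) (- bump_deriv \<eta> (y + t *\<^sub>R e) x e)"
      by (auto simp: bump_deriv_commute[of \<eta> x] linear_scale[OF linear_bump_deriv] fun_eq_iff)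
    ultimately have "((\<lambda>t. bump \<eta> (y + t *\<^sub>R e) x) has_field_derivative
        - bump_deriv \<eta> (y + t *\<^sub>R e) x e) (at t within {-1..1})"
      by (simp only: has_field_derivative_def bump_commute[of \<eta> x])
    then show "((\<lambda>t. w x * bump \<eta> (y + t *\<^sub>R e) x) has_field_derivative
        w x * - bump_deriv \<eta> (y + t *\<^sub>R e) x e) (at t within {-1..1})"
      by (rule DERIV_cmult)
  next
    fix t :: real
    show "(\<lambda>x. w x * bump \<eta> (y + t *\<^sub>R e) x) integrable_on cbox a b"
      by (intro integrable_continuous continuous_intros w)
  next
    have "continuous_on ({-1..1} \<times> cbox a b) (\<lambda>z. w (snd z))"
      by (rule continuous_on_compose2[OF w]) (auto intro!: continuous_intros)
    then show "continuous_on ({-1..1} \<times> cbox a b) (\<lambda>(t, x). w x * - bump_deriv \<eta> (y + t *\<^sub>R e) x e)"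
      unfolding split_beta by (intro continuous_intros)
  qed auto
  then show ?thesis by simp
qed

text \<open>
  Friedrichs' commutator: differentiating the mollification of \<open>w\<close> at \<open>y\<close> along the frozen vector \<open>Y y\<close>
  differs little from mollifying the weak derivative of \<open>w\<close> along \<open>Y\<close>. The difference is the integral of
  \<open>w\<close> against the divergence of \<open>bump \<eta> y \<cdot> (Y - Y y)\<close>. That divergence has integral zero, so \<open>w\<close> may be
  replaced by \<open>w - w y\<close>, which is bounded by the oscillation \<open>\<omega>\<close>. Its modulus has an integral of the
  order of the mass of the bump: the factor \<open>norm (Y x - Y y) \<le> L * norm (x - y)\<close> compensates the large
  gradient of the bump.
\<close>

lemma commutator_estimate:
  fixes L T \<omega> :: real and w :: "real^'n \<Rightarrow> real" and Y :: "real^'n \<Rightarrow> real^'n"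
  assumes "open S" and S: "cbox a b \<subseteq> S"
    and Y': "\<And>x. x \<in> S \<Longrightarrow> (Y has_derivative Y' x) (at x)"
    and contY': "\<And>h. continuous_on S (\<lambda>x. Y' x h)"
    and w: "continuous_on (cbox a b) w"
    and \<eta>: "0 < \<eta>" and y: "cball y \<eta> \<subseteq> cbox a b"
    and Lip: "\<And>x. x \<in> cbox a b \<Longrightarrow> norm (Y x - Y y) \<le> L * norm (x - y)"
    and T: "\<And>x. x \<in> cbox a b \<Longrightarrow> \<bar>trace (matrix (Y' x))\<bar> \<le> T"
    and osc: "\<And>x. x \<in> ball y \<eta> \<Longrightarrow> \<bar>w x - w y\<bar> \<le> \<omega>"
  shows "\<bar>integral (cbox a b) (\<lambda>x. w x * (bump_deriv \<eta> y x (Y x) + bump \<eta> y x * trace (matrix (Y' x))))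
      - integral (cbox a b) (\<lambda>x. w x * bump_deriv \<eta> y x (Y y))\<bar>
    \<le> \<omega> * (CARD('n) * L + T) * bump_mass TYPE(real^'n) \<eta>"
proof -
  let ?Q = "cbox a b"
  define D where "D x = bump_deriv \<eta> y x (Y x - Y y) + bump \<eta> y x * trace (matrix (Y' x))" for x
  have yb: "ball y \<eta> \<subseteq> ?Q" using y ball_subset_cball by blast
  have y_in: "y \<in> ?Q" using y \<eta> by (simp add: subset_iff)
  have contY: "continuous_on S Y"
    using has_derivative_continuous[OF Y'] by (intro continuous_at_imp_continuous_on) simp
  have contYQ: "continuous_on ?Q Y" using contY S by (rule continuous_on_subset)
  have contT: "continuous_on ?Q (\<lambda>x. trace (matrix (Y' x)))"
    unfolding trace_def matrix_def using continuous_on_subset[OF contY' S]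
    by (auto intro!: continuous_intros)
  have contD: "continuous_on ?Q D"
    unfolding D_def by (intro continuous_intros contYQ contT)
  have D0: "D x = 0" if "x \<notin> ball y \<eta>" for x
    using bump_outside[OF \<eta> that] bump_deriv_outside[OF \<eta> that] by (simp add: D_def)
  \<comment> \<open>\<open>D\<close> is the divergence of the compactly supported field \<open>bump \<eta> y \<cdot> (Y - Y y)\<close>.\<close>
  have D_int: "integral ?Q D = 0"
  proof -
    define G where "G x = (if x \<in> S then bump \<eta> y x *\<^sub>R (Y x - Y y) else 0)" for x
    define G' where "G' x = (if x \<in> S then \<lambda>h. bump_deriv \<eta> y x h *\<^sub>R (Y x - Y y) + bump \<eta> y x *\<^sub>R Y' x h
      else (\<lambda>h. 0))" for x
    have "open (- cball y \<eta>)" by (simp add: open_Compl)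
    have zero: "bump \<eta> y x = 0" "bump_deriv \<eta> y x h = 0" if "x \<in> - cball y \<eta>" for x h
      using that \<eta> by (auto intro!: bump_outside bump_deriv_outside)
    have cov: "x \<in> S \<or> x \<in> - cball y \<eta>" for x
      using y S by blast
    have "((\<lambda>x. trace (matrix (G' x))) has_integral 0) UNIV"
    proof (rule integral_divergence_eq_0[of "cball y \<eta>"])
      show "G x = 0" if "x \<notin> cball y \<eta>" for x
        using that zero by (simp add: G_def)
      show "(G has_derivative G' x) (at x)" for x
      proof (cases "x \<in> S")
        case True
        have "((\<lambda>x. bump \<eta> y x *\<^sub>R (Y x - Y y)) has_derivative
            (\<lambda>h. bump_deriv \<eta> y x h *\<^sub>R (Y x - Y y) + bump \<eta> y x *\<^sub>R Y' x h)) (at x)"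
          by (auto intro!: derivative_eq_intros has_derivative_bump Y' True)
        then show ?thesis
          unfolding G'_def if_P[OF True]
          by (rule has_derivative_transform_within_open[OF _ \<open>open S\<close> True]) (simp add: G_def)
      next
        case False
        then have "x \<in> - cball y \<eta>" using cov by blast
        then have "(G has_derivative (\<lambda>_. 0)) (at x)"
          by (rule has_derivative_transform_within_open[OF has_derivative_const \<open>open (- cball y \<eta>)\<close>])
             (simp add: G_def zero)
        then show ?thesis using False by (simp add: G'_def)
      qed
      show "continuous_on UNIV (\<lambda>x. G' x e)" for e
      proof -
        have "continuous_on S (\<lambda>x. bump_deriv \<eta> y x e *\<^sub>R (Y x - Y y) + bump \<eta> y x *\<^sub>R Y' x e)"
          by (intro continuous_intros contY contY')
        then have "continuous_on S (\<lambda>x. G' x e)"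
          by (rule continuous_on_eq) (simp add: G'_def)
        moreover have "continuous_on (- cball y \<eta>) (\<lambda>x. G' x e)"
          by (rule continuous_on_eq[OF continuous_on_const[of _ 0]]) (simp add: G'_def zero)
        ultimately have "continuous_on (S \<union> - cball y \<eta>) (\<lambda>x. G' x e)"
          using \<open>open S\<close> \<open>open (- cball y \<eta>)\<close> by (intro continuous_on_open_Un)
        moreover have "S \<union> - cball y \<eta> = UNIV" using cov by blast
        ultimately show ?thesis by simp
      qed
    qed simp
    then have "integral UNIV (\<lambda>x. trace (matrix (G' x))) = 0"
      by (rule integral_unique)
    moreover have "integral ?Q (\<lambda>x. trace (matrix (G' x))) = integral UNIV (\<lambda>x. trace (matrix (G' x)))"
    proof (rule integral_eq_integral_UNIV)
      fix x assume "x \<notin> ?Q"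
      then have "x \<in> - cball y \<eta>" using y by blast
      then show "trace (matrix (G' x)) = 0" by (simp add: G'_def zero trace_def matrix_def)
    qed
    moreover have "integral ?Q (\<lambda>x. trace (matrix (G' x))) = integral ?Q D"
    proof (rule integral_cong)
      fix x assume "x \<in> ?Q"
      then have "x \<in> S" using S by blast
      then show "trace (matrix (G' x)) = D x"
        by (simp add: G'_def D_def trace_matrix_sum[OF linear_bump_deriv])
    qed
    ultimately show ?thesis by simp
  qed
  have "integral ?Q (\<lambda>x. w x * (bump_deriv \<eta> y x (Y x) + bump \<eta> y x * trace (matrix (Y' x))))
      - integral ?Q (\<lambda>x. w x * bump_deriv \<eta> y x (Y y)) = integral ?Q (\<lambda>x. w x * D x)"
    by (subst Henstock_Kurzweil_Integration.integral_diff[symmetric])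
      (auto intro!: integrable_continuous continuous_intros contYQ contT w integral_cong
        simp: D_def linear_diff[OF linear_bump_deriv] algebra_simps)
  also have "\<dots> = integral ?Q (\<lambda>x. (w x - w y) * D x) + w y * integral ?Q D"
    by (subst Henstock_Kurzweil_Integration.integral_mult_right[symmetric],
        subst Henstock_Kurzweil_Integration.integral_add[symmetric])
      (auto intro!: integrable_continuous continuous_intros contD w integral_cong simp: algebra_simps)
  also have "\<dots> = integral ?Q (\<lambda>x. (w x - w y) * D x)" by (simp add: D_int)
  finally have eq: "integral ?Q (\<lambda>x. w x * (bump_deriv \<eta> y x (Y x) + bump \<eta> y x * trace (matrix (Y' x))))
      - integral ?Q (\<lambda>x. w x * bump_deriv \<eta> y x (Y y)) = integral ?Q (\<lambda>x. (w x - w y) * D x)" .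
  have "norm (integral ?Q (\<lambda>x. (w x - w y) * D x))
      \<le> integral ?Q (\<lambda>x. \<omega> * (L * (- bump_deriv \<eta> y x (x - y)) + T * bump \<eta> y x))"
  proof (rule integral_norm_bound_integral)
    show "(\<lambda>x. (w x - w y) * D x) integrable_on ?Q"
      by (intro integrable_continuous continuous_intros w contD)
    show "(\<lambda>x. \<omega> * (L * (- bump_deriv \<eta> y x (x - y)) + T * bump \<eta> y x)) integrable_on ?Q"
      by (intro integrable_continuous continuous_intros)
    fix x assume x: "x \<in> ?Q"
    show "norm ((w x - w y) * D x) \<le> \<omega> * (L * (- bump_deriv \<eta> y x (x - y)) + T * bump \<eta> y x)"
    proof (cases "x \<in> ball y \<eta>")
      case True
      have "\<bar>D x\<bar> \<le> \<bar>bump_deriv \<eta> y x (Y x - Y y)\<bar> + bump \<eta> y x * \<bar>trace (matrix (Y' x))\<bar>"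
        unfolding D_def by (rule order_trans[OF abs_triangle_ineq]) (simp add: abs_mult bump_nonneg)
      also have "\<dots> \<le> L * (- bump_deriv \<eta> y x (x - y)) + T * bump \<eta> y x"
        using bump_deriv_radial_bound[OF Lip[OF x]] mult_left_mono[OF T[OF x] bump_nonneg]
        by (intro add_mono) (simp_all add: mult.commute)
      finally have "\<bar>w x - w y\<bar> * \<bar>D x\<bar> \<le> \<omega> * (L * (- bump_deriv \<eta> y x (x - y)) + T * bump \<eta> y x)"
        using osc[OF True] by (intro mult_mono) auto
      then show ?thesis by (simp add: abs_mult)
    next
      case False
      then show ?thesis
        by (simp add: D0 bump_outside[OF \<eta>] bump_deriv_outside[OF \<eta>] del: mem_ball)
    qed
  qed
  also have "\<dots> = \<omega> * (L * (- integral ?Q (\<lambda>x. bump_deriv \<eta> y x (x - y))) + T * integral ?Q (bump \<eta> y))"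
    by (subst Henstock_Kurzweil_Integration.integral_mult_right,
        subst Henstock_Kurzweil_Integration.integral_add)
      (auto intro!: integrable_continuous continuous_intros)
  also have "\<dots> = \<omega> * (CARD('n) * L + T) * bump_mass TYPE(real^'n) \<eta>"
    by (simp add: integral_bump_deriv_radial[OF \<eta> yb] integral_bump[OF \<eta> yb] algebra_simps)
  finally show ?thesis by (simp add: eq)
qed

section \<open>A maximum principle\<close>

lemma bounded_derivative_on_compact:
  fixes Y' :: "real^'n \<Rightarrow> real^'n \<Rightarrow> 'b::real_normed_vector"
  assumes "compact K" and lin: "\<And>x. x \<in> K \<Longrightarrow> linear (Y' x)"
    and cont: "\<And>h. continuous_on K (\<lambda>x. Y' x h)"
  obtains L where "0 \<le> L" "\<And>x h. x \<in> K \<Longrightarrow> norm (Y' x h) \<le> L * norm h"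
proof -
  have "\<exists>B. \<forall>x\<in>K. norm (Y' x h) \<le> B" for h
    using compact_imp_bounded[OF compact_continuous_image[OF cont \<open>compact K\<close>]]
    by (auto simp: bounded_iff)
  then obtain B where B: "\<And>x h. x \<in> K \<Longrightarrow> norm (Y' x h) \<le> B h" by metis
  define L where "L = (\<Sum>i\<in>UNIV. \<bar>B (axis i 1)\<bar>)"
  have "norm (Y' x h) \<le> L * norm h" if x: "x \<in> K" for x h
  proof -
    have "Y' x h = Y' x (\<Sum>i\<in>UNIV. h $ i *\<^sub>R axis i 1)"
      using basis_expansion[of h] by (simp add: scalar_mult_eq_scaleR)
    also have "\<dots> = (\<Sum>i\<in>UNIV. h $ i *\<^sub>R Y' x (axis i 1))"
      by (simp add: linear_sum[OF lin[OF x]] linear_scale[OF lin[OF x]])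
    also have "norm \<dots> \<le> (\<Sum>i\<in>UNIV. norm h * \<bar>B (axis i 1)\<bar>)"
    proof (intro sum_norm_le)
      fix i
      have "norm (Y' x (axis i 1)) \<le> \<bar>B (axis i 1)\<bar>" using B[OF x, of "axis i 1"] by linarith
      then show "norm (h $ i *\<^sub>R Y' x (axis i 1)) \<le> norm h * \<bar>B (axis i 1)\<bar>"
        using component_le_norm_cart[of h i] by (auto intro: mult_mono)
    qed
    also have "\<dots> = L * norm h" by (simp add: L_def sum_distrib_left mult.commute)
    finally show ?thesis .
  qed
  moreover have "0 \<le> L" by (simp add: L_def sum_nonneg)
  ultimately show ?thesis by (rule that[rotated])
qed

text \<open>
  A continuous function with weak derivative at least \<open>\<epsilon> > 0\<close> along \<open>Y\<close> has no local maximum. For a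
  \<open>C\<^sup>1\<close> function this is immediate; here \<open>w\<close> need not be differentiable in any direction and \<open>Y x0\<close> may
  vanish. The mollification \<open>f\<close> of \<open>w\<close> at a small scale \<open>\<eta>\<close> is differentiable, and by the commutator
  estimate its derivative along \<open>Y\<close> is at least \<open>\<epsilon> / 2\<close> times the mass \<open>N\<close> of the bump. If
  \<open>norm (Y x) \<le> M\<close> and \<open>c * M < \<epsilon> / 2\<close>, then \<open>f y - c * N * norm (y - x0)\<close> increases in direction \<open>Y y\<close> at
  every \<open>y\<close>, so its maximum over a ball lies on the boundary sphere. Hence \<open>f\<close>
  exceeds \<open>f x0\<close> by \<open>c * N * r\<close> at some point of the sphere, whereas up to the oscillation \<open>\<omega>\<close> of \<open>w\<close>
  at scale \<open>\<eta>\<close>, which can be made smaller than \<open>c * r\<close>, the value \<open>f x0\<close> is the maximal one.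
\<close>

lemma no_local_max_if_weakly_increasing:
  fixes w :: "real^'n \<Rightarrow> real" and Y :: "real^'n \<Rightarrow> real^'n"
  assumes "open S" and S: "cbox a b \<subseteq> S"
    and Y': "\<And>x. x \<in> S \<Longrightarrow> (Y has_derivative Y' x) (at x)"
    and contY': "\<And>h. continuous_on S (\<lambda>x. Y' x h)"
    and w: "continuous_on (cbox a b) w"
    and R: "0 < R" "cball x0 R \<subseteq> cbox a b"
    and \<epsilon>: "0 < \<epsilon>"
    and weak: "\<And>y \<eta>. \<lbrakk>0 < \<eta>; cball y \<eta> \<subseteq> cball x0 R\<rbrakk> \<Longrightarrow>
      \<epsilon> * integral (cbox a b) (bump \<eta> y)
        \<le> - integral (cbox a b) (\<lambda>x. w x * (bump_deriv \<eta> y x (Y x) + bump \<eta> y x * trace (matrix (Y' x))))"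
    and max: "\<And>x. x \<in> cball x0 R \<Longrightarrow> w x \<le> w x0"
  shows False
proof -
  let ?Q = "cbox a b"
  have contY: "continuous_on ?Q Y"
    using has_derivative_continuous[OF Y'] S by (intro continuous_at_imp_continuous_on) auto
  have contYQ': "continuous_on ?Q (\<lambda>x. Y' x h)" for h
    using contY' S by (rule continuous_on_subset)
  obtain M0 where M0: "\<And>x. x \<in> ?Q \<Longrightarrow> norm (Y x) \<le> M0"
    using compact_imp_bounded[OF compact_continuous_image[OF contY compact_cbox]]
    by (auto simp: bounded_iff)
  define M where "M = \<bar>M0\<bar> + 1"
  have M: "0 < M" "\<And>x. x \<in> ?Q \<Longrightarrow> norm (Y x) \<le> M"
    using M0 by (force simp: M_def)+
  have contT: "continuous_on ?Q (\<lambda>x. trace (matrix (Y' x)))"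
    unfolding trace_def matrix_def using contYQ' by (auto intro!: continuous_intros)
  obtain T0 where T0: "\<And>x. x \<in> ?Q \<Longrightarrow> norm (trace (matrix (Y' x))) \<le> T0"
    using compact_imp_bounded[OF compact_continuous_image[OF contT compact_cbox]]
    by (auto simp: bounded_iff)
  define T where "T = \<bar>T0\<bar>"
  have T: "0 \<le> T" "\<And>x. x \<in> ?Q \<Longrightarrow> \<bar>trace (matrix (Y' x))\<bar> \<le> T"
    using T0 by (force simp: T_def)+
  have "linear (Y' x)" if "x \<in> ?Q" for x
    using has_derivative_linear[OF Y'] S that by blast
  then obtain L where L: "0 \<le> L" "\<And>x h. x \<in> ?Q \<Longrightarrow> norm (Y' x h) \<le> L * norm h"
    using bounded_derivative_on_compact[OF compact_cbox, of a b Y'] contYQ' by blast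
  have Lip: "norm (Y x - Y y) \<le> L * norm (x - y)" if "x \<in> ?Q" "y \<in> ?Q" for x y
  proof (rule differentiable_bound[of ?Q Y Y'])
    show "(Y has_derivative Y' z) (at z within ?Q)" if "z \<in> ?Q" for z
      using Y' S that has_derivative_at_withinI by blast
    show "onorm (Y' z) \<le> L" if "z \<in> ?Q" for z
      using L that by (intro onorm_bound) auto
  qed (use that in auto)

  \<comment> \<open>The constants: \<open>K\<close> comes from the commutator estimate, and \<open>\<omega>\<close> is small enough both for
     \<open>\<omega> * K \<le> \<epsilon> / 2\<close> and for \<open>\<omega> < c * r\<close> with \<open>r = R / 2\<close>.\<close>
  define K where "K = CARD('n) * L + T"
  have K: "0 \<le> K" using L(1) T(1) by (simp add: K_def)
  define c where "c = \<epsilon> / (4 * M)"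
  have c: "0 < c" "c * M < \<epsilon> / 2" using \<epsilon> M(1) by (auto simp: c_def)
  define \<omega> where "\<omega> = min (\<epsilon> / (2 * (K + 1))) (c * R / 4)"
  have \<omega>: "0 < \<omega>" using \<epsilon> K c(1) R(1) by (simp add: \<omega>_def)
  have "\<omega> \<le> c * R / 4" unfolding \<omega>_def by (rule min.cobounded2)
  moreover have "0 < c * R" using c(1) R(1) by simp
  ultimately have \<omega>_less: "\<omega> < c * (R / 2)" by simp
  have "\<omega> \<le> \<epsilon> / (2 * (K + 1))" unfolding \<omega>_def by (rule min.cobounded1)
  then have "\<omega> * (2 * (K + 1)) \<le> \<epsilon>" using K by (subst (asm) pos_le_divide_eq) auto
  then have \<omega>K: "\<omega> * K \<le> \<epsilon> / 2" using \<omega> by (simp add: algebra_simps)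
  have "uniformly_continuous_on ?Q w"
    using compact_uniformly_continuous[OF w compact_cbox] .
  then obtain \<delta> where \<delta>: "0 < \<delta>" "\<And>x y. \<lbrakk>x \<in> ?Q; y \<in> ?Q; dist x y < \<delta>\<rbrakk> \<Longrightarrow> dist (w x) (w y) < \<omega>"
    unfolding uniformly_continuous_on_def using \<omega> by metis
  define r where "r = R / 2"
  define \<eta> where "\<eta> = min \<delta> (R / 4)"
  have r: "0 < r" using R(1) by (simp add: r_def)
  have \<eta>: "0 < \<eta>" "\<eta> \<le> \<delta>" "r + \<eta> \<le> R" using \<delta>(1) R(1) by (auto simp: \<eta>_def r_def)
  have ball_R: "cball y \<eta> \<subseteq> cball x0 R" if "y \<in> cball x0 r" for y
  proof -
    have "dist x0 y \<le> r" using that by simp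
    then have "dist x0 z \<le> R" if "dist y z \<le> \<eta>" for z
      using dist_triangle[of x0 z y] \<eta>(3) that by linarith
    then show ?thesis by auto
  qed
  have ball_Q: "cball y \<eta> \<subseteq> ?Q" if "y \<in> cball x0 r" for y
    using ball_R[OF that] R(2) by blast
  have in_Q: "y \<in> ?Q" if "y \<in> cball x0 r" for y
    using ball_Q[OF that] \<eta>(1) by (simp add: subset_iff)
  have osc: "\<bar>w x - w y\<bar> \<le> \<omega>" if "y \<in> cball x0 r" "x \<in> ball y \<eta>" for x y
  proof -
    have "x \<in> ?Q" using ball_Q[OF that(1)] that(2) by (auto simp: subset_iff)
    moreover have "dist x y < \<delta>" using that(2) \<eta>(2) by (simp add: dist_commute)
    ultimately show ?thesis using \<delta>(2)[OF _ in_Q[OF that(1)]] by (force simp: dist_real_def)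
  qed

  define N where "N = bump_mass TYPE(real^'n) \<eta>"
  have N: "0 < N" unfolding N_def by (rule bump_mass_pos[OF \<eta>(1)])
  have mass: "integral ?Q (bump \<eta> y) = N" if "y \<in> cball x0 r" for y
    unfolding N_def using ball_Q[OF that] by (intro integral_bump \<eta>) auto
  define f where "f y = integral ?Q (\<lambda>x. w x * bump \<eta> y x)" for y
  have contf: "continuous_on UNIV f"
  proof -
    have "continuous_on (UNIV \<times> ?Q) (\<lambda>z::(real^'n) \<times> (real^'n). w (snd z))"
      by (rule continuous_on_compose2[OF w]) (auto intro!: continuous_intros)
    then have "continuous_on (UNIV \<times> ?Q) (\<lambda>(y, x). w x * bump \<eta> y x)"
      unfolding split_beta by (intro continuous_intros)
    then show ?thesis unfolding f_def by (rule integral_continuous_on_param)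
  qed
  have int_bump: "(\<lambda>x. w x * bump \<eta> y x) integrable_on ?Q" "(\<lambda>x. k * bump \<eta> y x) integrable_on ?Q" for k y
    by (intro integrable_continuous continuous_intros w)+
  have f_le: "f y \<le> w x0 * N" if y: "y \<in> cball x0 r" for y
  proof -
    have "w x * bump \<eta> y x \<le> w x0 * bump \<eta> y x" for x
    proof (cases "x \<in> ball y \<eta>")
      case True
      then have "x \<in> cball x0 R" using ball_R[OF y] by (auto simp: subset_iff)
      then show ?thesis by (intro mult_right_mono max bump_nonneg)
    qed (simp add: bump_outside[OF \<eta>(1)])
    then have "f y \<le> integral ?Q (\<lambda>x. w x0 * bump \<eta> y x)"
      unfolding f_def by (intro integral_le int_bump)
    then show ?thesis by (simp add: mass[OF y])
  qed
  have x0: "x0 \<in> cball x0 r" using r by simp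
  have f_ge: "(w x0 - \<omega>) * N \<le> f x0"
  proof -
    have "(w x0 - \<omega>) * bump \<eta> x0 x \<le> w x * bump \<eta> x0 x" for x
    proof (cases "x \<in> ball x0 \<eta>")
      case True
      then show ?thesis using osc[OF x0 True] by (intro mult_right_mono bump_nonneg) linarith
    qed (simp add: bump_outside[OF \<eta>(1)])
    then have "integral ?Q (\<lambda>x. (w x0 - \<omega>) * bump \<eta> x0 x) \<le> f x0"
      unfolding f_def by (intro integral_le int_bump)
    then show ?thesis by (simp add: mass[OF x0])
  qed

  \<comment> \<open>The penalty is Lipschitz with a constant too small to cancel the growth of \<open>f\<close> along \<open>Y\<close>.\<close>
  define F where "F y = f y - c * N * norm (y - x0)" for y
  have "continuous_on (cball x0 r) F"
    unfolding F_def by (intro continuous_intros continuous_on_subset[OF contf]) auto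
  then obtain y1 where y1: "y1 \<in> cball x0 r" and y1_max: "\<And>y. y \<in> cball x0 r \<Longrightarrow> F y \<le> F y1"
    using continuous_attains_sup[of "cball x0 r" F] r by auto
  have "norm (y1 - x0) = r"
  proof (rule ccontr)
    assume "norm (y1 - x0) \<noteq> r"
    then have inside: "norm (y1 - x0) < r" using y1 by (simp add: dist_norm norm_minus_commute)
    define e where "e = Y y1"
    have e: "norm e \<le> M" unfolding e_def by (rule M(2)[OF in_Q[OF y1]])
    define D where "D = - integral ?Q (\<lambda>x. w x * bump_deriv \<eta> y1 x e)"
    have deriv: "((\<lambda>t. f (y1 + t *\<^sub>R e)) has_real_derivative D) (at 0 within {-1..1})"
      unfolding f_def D_def by (rule mollification_directional_derivative[OF w])
    have comm: "\<bar>integral ?Q (\<lambda>x. w x * (bump_deriv \<eta> y1 x (Y x) + bump \<eta> y1 x * trace (matrix (Y' x))))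
        - integral ?Q (\<lambda>x. w x * bump_deriv \<eta> y1 x (Y y1))\<bar> \<le> \<omega> * K * N"
      unfolding K_def N_def
      by (rule commutator_estimate[OF \<open>open S\<close> S Y' contY' w \<eta>(1) ball_Q[OF y1] Lip T(2) osc[OF y1]])
         (auto intro: in_Q[OF y1])
    have "\<omega> * K * N \<le> \<epsilon> / 2 * N" using \<omega>K N by (intro mult_right_mono) auto
    moreover have "\<epsilon> * N
        \<le> - integral ?Q (\<lambda>x. w x * (bump_deriv \<eta> y1 x (Y x) + bump \<eta> y1 x * trace (matrix (Y' x))))"
      using weak[OF \<eta>(1) ball_R[OF y1]] by (simp add: mass[OF y1])
    ultimately have "\<epsilon> / 2 * N \<le> D" using comm unfolding D_def e_def by linarith
    moreover have "c * M * N < \<epsilon> / 2 * N" using c(2) N by (rule mult_strict_right_mono)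
    moreover have "c * M * N = c * N * M" by simp
    ultimately have pos: "0 < D - c * N * M" by linarith
    \<comment> \<open>A step from \<open>y1\<close> in direction \<open>Y y1\<close> would increase \<open>F\<close>.\<close>
    define g where "g t = f (y1 + t *\<^sub>R e) - c * N * M * t" for t
    have "(g has_real_derivative D - c * N * M) (at 0 within {-1..1})"
      unfolding g_def using deriv by (auto intro!: derivative_eq_intros)
    then obtain d where d: "0 < d" "\<And>h. \<lbrakk>0 < h; 0 + h \<in> {-1..1}; h < d\<rbrakk> \<Longrightarrow> g 0 < g (0 + h)"
      using has_real_derivative_pos_inc_right[OF _ pos] by blast
    define h where "h = min (min (d / 2) 1) ((r - norm (y1 - x0)) / M)"
    have "0 < h" using d(1) inside M(1) by (simp add: h_def)
    moreover have "h \<le> d / 2" "h \<le> 1" "h \<le> (r - norm (y1 - x0)) / M"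
      unfolding h_def by linarith+
    ultimately have h: "0 < h" "h < d" "h \<le> 1" "h * M \<le> r - norm (y1 - x0)"
      using M(1) d(1) by (auto simp: pos_le_divide_eq)
    have "norm (h *\<^sub>R e) \<le> h * M" using e h(1) by simp
    then have tri: "norm (y1 + h *\<^sub>R e - x0) \<le> norm (y1 - x0) + h * M"
      using norm_triangle_ineq[of "y1 - x0" "h *\<^sub>R e"] by (simp add: algebra_simps)
    then have "y1 + h *\<^sub>R e \<in> cball x0 r"
      using h(4) by (simp add: dist_norm norm_minus_commute)
    then have "F (y1 + h *\<^sub>R e) \<le> F y1" by (rule y1_max)
    moreover have "c * N * norm (y1 + h *\<^sub>R e - x0) \<le> c * N * (norm (y1 - x0) + h * M)"
      using tri c(1) N by (intro mult_left_mono) auto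
    ultimately have "g h \<le> g 0" by (simp add: F_def g_def algebra_simps)
    then show False using d(2)[of h] h by simp
  qed
  moreover have "F x0 \<le> F y1" by (rule y1_max[OF x0])
  ultimately have "(w x0 - \<omega>) * N \<le> w x0 * N - c * N * r"
    using f_ge f_le[OF y1] by (simp add: F_def)
  then have "c * r * N \<le> \<omega> * N" by (simp add: algebra_simps)
  then have "c * r \<le> \<omega>" using N by simp
  then show False using \<omega>_less by (simp add: r_def)
qed

section \<open>Distributional horizontal gradients\<close>

lemma set_integrable_mult_continuous:
  fixes f D :: "'a::euclidean_space \<Rightarrow> real"
  assumes "set_integrable lebesgue K f" "compact K" "continuous_on K D"
  shows "set_integrable lebesgue K (\<lambda>x. D x * f x)"
proof (rule absolutely_integrable_bounded_measurable_product[OF bilinear_times])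
  show "K \<in> sets lebesgue" using \<open>compact K\<close> by (simp add: borel_compact)
  then show "D \<in> borel_measurable (lebesgue_on K)"
    by (rule continuous_imp_measurable_on_sets_lebesgue[OF assms(3)])
  show "bounded (D ` K)"
    by (rule compact_imp_bounded[OF compact_continuous_image[OF assms(3,2)]])
qed (rule assms(1))

lemma bounded_linear_vector_matrix_mult: "bounded_linear (\<lambda>A::real^'n^'m. \<xi> v* A)"
  unfolding linear_conv_bounded_linear[symmetric]
  by (rule linearI) (simp_all add: vec_eq_iff vector_matrix_mult_def sum.distrib sum_distrib_left algebra_simps)

lemma scaleR_vector_matrix_mult: "(c *\<^sub>R \<xi>) v* A = c *\<^sub>R (\<xi> v* A)" for A :: "real^'n^'m"
  by (simp add: vec_eq_iff vector_matrix_mult_def sum_distrib_left algebra_simps)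

lemma divergence_eq_0:
  assumes "open U" "x \<in> U" "\<And>y. y \<in> U \<Longrightarrow> F y = 0"
  shows "divergence F x = 0"
proof -
  have "(F has_derivative (\<lambda>_. 0)) (at x)"
    by (rule has_derivative_transform_within_open[OF has_derivative_const assms(1,2)])
       (simp add: assms(3))
  then have "frechet_derivative F (at x) = (\<lambda>_. 0)"
    using frechet_derivative_at by metis
  then show ?thesis by (simp add: divergence_def jacobian_def trace_def matrix_def)
qed

lemma smooth_on_derivative:
  assumes "smooth_on \<Omega> C"
  shows "x \<in> \<Omega> \<Longrightarrow> (C has_derivative frechet_derivative C (at x)) (at x)"
    and "continuous_on \<Omega> (\<lambda>x. frechet_derivative C (at x) h)"
proof -
  have "Ck_on (Suc 0) \<Omega> C" using assms by (simp add: smooth_on_def)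
  then show "x \<in> \<Omega> \<Longrightarrow> (C has_derivative frechet_derivative C (at x)) (at x)"
    and "continuous_on \<Omega> (\<lambda>x. frechet_derivative C (at x) h)"
    by (auto simp: frechet_derivative_works)
qed

lemma set_integral_eq_on_support:
  assumes "A \<subseteq> B" "\<And>x. x \<in> A \<Longrightarrow> f x = g x" "\<And>x. x \<in> B - A \<Longrightarrow> f x = 0"
  shows "set_lebesgue_integral M B f = set_lebesgue_integral M A g"
  unfolding set_lebesgue_integral_def
  by (rule Bochner_Integration.integral_cong) (use assms in \<open>auto simp: indicator_def\<close>)

text \<open>
  The test field \<open>bump \<eta> y \<cdot> \<xi>\<close> in the definition of the distributional gradient turns it into the weak
  derivative along the single field \<open>\<xi> v* C\<close>. Both sides are supported in the box, so that integrals over \<open>\<Omega>\<close>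
  become Henstock integrals of continuous functions, and the continuous representative replaces \<open>u\<close>.
\<close>

lemma hgrad_against_bump:
  fixes C :: "real^'n \<Rightarrow> real^'n^'m" and \<xi> :: "real^'m"
  assumes "open \<Omega>" and C: "smooth_on \<Omega> C" and hg: "is_hgrad \<Omega> C u g"
    and rep: "continuous_representative \<Omega> u v"
    and Q: "cbox a b \<subseteq> \<Omega>" and \<eta>: "0 < \<eta>" and y: "cball y \<eta> \<subseteq> cbox a b"
  shows "- integral (cbox a b) (\<lambda>x. v x * (bump_deriv \<eta> y x (\<xi> v* C x)
      + bump \<eta> y x * trace (matrix (\<lambda>h. \<xi> v* frechet_derivative C (at x) h))))
    = (LINT x:cbox a b|lebesgue. bump \<eta> y x * (\<xi> \<bullet> g x))"
proof -
  let ?Q = "cbox a b"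
  define D where "D x = bump_deriv \<eta> y x (\<xi> v* C x)
      + bump \<eta> y x * trace (matrix (\<lambda>h. \<xi> v* frechet_derivative C (at x) h))" for x
  define \<phi> where "\<phi> x = bump \<eta> y x *\<^sub>R \<xi>" for x
  have yQ: "ball y \<eta> \<subseteq> ?Q" using y ball_subset_cball by blast
  have \<phi>0: "\<phi> x = 0" and D0: "D x = 0" if "x \<notin> ball y \<eta>" for x
    using that by (simp_all add: \<phi>_def D_def bump_outside[OF \<eta>] bump_deriv_outside[OF \<eta>] del: mem_ball)
  have "\<phi> \<in> test_functions \<Omega>"
    unfolding \<phi>_def
    by (rule test_functionsI[OF flat_algebra_bump compact_cball, of y \<eta>])
       (use y Q in \<open>auto intro!: bump_outside[OF \<eta>]\<close>)
  then have eq: "- (LINT x:\<Omega>|lebesgue. u x * divergence (\<lambda>z. \<phi> z v* C z) x) = (LINT x:\<Omega>|lebesgue. g x \<bullet> \<phi> x)"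
    using hg by (simp add: is_hgrad_def distr_hgrad_def)
  have contC: "continuous_on \<Omega> C"
    using has_derivative_continuous[OF smooth_on_derivative(1)[OF C]]
    by (intro continuous_at_imp_continuous_on) simp
  have contD: "continuous_on ?Q D"
  proof -
    note lin = bounded_linear.continuous_on[OF bounded_linear_vector_matrix_mult]
    have "continuous_on ?Q (\<lambda>x. \<xi> v* C x)" "continuous_on ?Q (\<lambda>x. \<xi> v* frechet_derivative C (at x) h)" for h
      using continuous_on_subset[OF contC Q] continuous_on_subset[OF smooth_on_derivative(2)[OF C] Q]
      by (auto intro: lin)
    then show ?thesis
      unfolding D_def trace_def matrix_def by (auto intro!: continuous_intros)
  qed
  have div: "divergence (\<lambda>z. \<phi> z v* C z) x = D x" if x: "x \<in> \<Omega>" for x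
  proof -
    have "((\<lambda>z. \<xi> v* C z) has_derivative (\<lambda>h. \<xi> v* frechet_derivative C (at x) h)) (at x)"
      by (rule bounded_linear.has_derivative[OF bounded_linear_vector_matrix_mult smooth_on_derivative(1)[OF C x]])
    from has_derivative_scaleR[OF has_derivative_bump this]
    have "((\<lambda>z. \<phi> z v* C z) has_derivative (\<lambda>h. bump_deriv \<eta> y x h *\<^sub>R (\<xi> v* C x)
        + bump \<eta> y x *\<^sub>R (\<xi> v* frechet_derivative C (at x) h))) (at x)"
      by (simp add: \<phi>_def scaleR_vector_matrix_mult add.commute)
    from frechet_derivative_at[OF this, symmetric] show ?thesis
      by (simp add: divergence_def jacobian_def D_def trace_matrix_sum[OF linear_bump_deriv])
  qed
  have "compact ?Q" by (rule compact_cbox)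
  have u_int: "set_integrable lebesgue ?Q u"
    using hg Q by (simp add: is_hgrad_def L1_loc_def)
  have v_cont: "continuous_on ?Q v"
    using rep Q by (auto simp: continuous_representative_def intro: continuous_on_subset)
  have v_int: "set_integrable lebesgue ?Q v"
    using v_cont by (rule absolutely_integrable_continuous)
  have "AE x in lebesgue. x \<in> \<Omega> \<longrightarrow> v x = u x"
    using rep \<open>open \<Omega>\<close> by (simp add: continuous_representative_def AE_restrict_space_iff)
  then have uv: "AE x in lebesgue. indicator ?Q x *\<^sub>R (D x * u x) = indicator ?Q x *\<^sub>R (D x * v x)"
    by eventually_elim (use Q in \<open>auto simp: indicator_def\<close>)
  have "(LINT x:\<Omega>|lebesgue. u x * divergence (\<lambda>z. \<phi> z v* C z) x) = (LINT x:?Q|lebesgue. D x * u x)"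
    using Q yQ D0 by (intro set_integral_eq_on_support) (auto simp: div subset_iff)
  also have "\<dots> = (LINT x:?Q|lebesgue. D x * v x)"
    using uv set_integrable_mult_continuous[OF u_int \<open>compact ?Q\<close> contD]
      set_integrable_mult_continuous[OF v_int \<open>compact ?Q\<close> contD]
    unfolding set_lebesgue_integral_def set_integrable_def
    by (intro integral_cong_AE) auto
  also have "\<dots> = integral ?Q (\<lambda>x. D x * v x)"
    by (rule set_lebesgue_integral_eq_integral(2)
        [OF set_integrable_mult_continuous[OF v_int \<open>compact ?Q\<close> contD]])
  finally have "(LINT x:\<Omega>|lebesgue. u x * divergence (\<lambda>z. \<phi> z v* C z) x) = integral ?Q (\<lambda>x. v x * D x)"
    by (simp add: mult.commute)
  moreover have "(LINT x:\<Omega>|lebesgue. g x \<bullet> \<phi> x) = (LINT x:?Q|lebesgue. bump \<eta> y x * (\<xi> \<bullet> g x))"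
  proof (rule set_integral_eq_on_support[OF Q])
    show "g x \<bullet> \<phi> x = bump \<eta> y x * (\<xi> \<bullet> g x)" for x
      by (simp add: \<phi>_def inner_commute)
    show "g x \<bullet> \<phi> x = 0" if "x \<in> \<Omega> - ?Q" for x
    proof -
      have "x \<notin> ball y \<eta>" using that yQ by blast
      then have "\<phi> x = 0" by (rule \<phi>0)
      then show ?thesis by simp
    qed
  qed
  ultimately show ?thesis using eq by (simp add: D_def)
qed

lemma set_integrable_component:
  fixes g :: "'a::euclidean_space \<Rightarrow> real^'m"
  assumes "set_integrable lebesgue K g"
  shows "set_integrable lebesgue K (\<lambda>x. \<xi> \<bullet> g x)"
  using integrable_inner_right[of \<xi>] assms by (fastforce simp: set_integrable_def)

text \<open>
  Test fields supported in \<open>V\<close> are test fields on \<open>\<Omega>\<close>, so the difference of the two gradients is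
  orthogonal to all of them, componentwise.
\<close>

lemma hgrad_unique:
  fixes C :: "real^'n \<Rightarrow> real^'n^'m"
  assumes hg: "is_hgrad \<Omega> C u g" and hf: "is_hgrad V C u f"
    and V: "V \<subseteq> \<Omega>" and R: "cball x0 R \<subseteq> V"
  shows "AE x in lebesgue. x \<in> ball x0 R \<longrightarrow> g x = f x"
proof -
  let ?B = "cball x0 R"
  have gi: "set_integrable lebesgue ?B g" using hg V R by (auto simp: is_hgrad_def L1_loc_def)
  have fi: "set_integrable lebesgue ?B f" using hf R by (auto simp: is_hgrad_def L1_loc_def)
  have "AE x in lebesgue. x \<in> ball x0 R \<longrightarrow> axis j 1 \<bullet> g x - axis j 1 \<bullet> f x = 0" for j
  proof (rule AE_zero_if_orthogonal_to_test_functions)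
    show "set_integrable lebesgue ?B (\<lambda>x. axis j 1 \<bullet> g x - axis j 1 \<bullet> f x)"
      by (intro set_integral_diff set_integrable_component gi fi)
  next
    fix \<psi> :: "real^'n \<Rightarrow> real" and K
    assume \<psi>: "flat_algebra \<psi>" "compact K" "K \<subseteq> ball x0 R" "\<And>x. x \<notin> K \<Longrightarrow> \<psi> x = 0"
    define \<phi> :: "real^'n \<Rightarrow> real^'m" where "\<phi> x = \<psi> x *\<^sub>R axis j 1" for x
    have K: "K \<subseteq> V" "K \<subseteq> \<Omega>" "K \<subseteq> ?B" using subset_trans[OF \<psi>(3) ball_subset_cball] R V by blast+
    have test: "\<phi> \<in> test_functions V" "\<phi> \<in> test_functions \<Omega>"
      unfolding \<phi>_def using \<psi> K by (auto intro: test_functionsI)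
    have "divergence (\<lambda>z. \<phi> z v* C z) x = 0" if "x \<notin> K" for x
      by (rule divergence_eq_0[of "- K"])
         (use that \<psi> in \<open>auto simp: \<phi>_def compact_imp_closed open_Compl\<close>)
    then have "distr_hgrad \<Omega> C u \<phi> = distr_hgrad V C u \<phi>"
      unfolding distr_hgrad_def using V K by (subst set_integral_eq_on_support) auto
    then have "(LINT x:\<Omega>|lebesgue. g x \<bullet> \<phi> x) = (LINT x:V|lebesgue. f x \<bullet> \<phi> x)"
      using hg hf test by (simp add: is_hgrad_def)
    moreover have "(LINT x:\<Omega>|lebesgue. g x \<bullet> \<phi> x) = (LINT x:?B|lebesgue. \<psi> x * (axis j 1 \<bullet> g x))"
      using V R K \<psi>(4) by (intro set_integral_eq_on_support) (auto simp: \<phi>_def inner_commute subset_iff)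
    moreover have "(LINT x:V|lebesgue. f x \<bullet> \<phi> x) = (LINT x:?B|lebesgue. \<psi> x * (axis j 1 \<bullet> f x))"
      using R K \<psi>(4) by (intro set_integral_eq_on_support) (auto simp: \<phi>_def inner_commute subset_iff)
    ultimately have eq: "(LINT x:?B|lebesgue. \<psi> x * (axis j 1 \<bullet> g x)) = (LINT x:?B|lebesgue. \<psi> x * (axis j 1 \<bullet> f x))"
      by simp
    have "set_integrable lebesgue ?B (\<lambda>x. \<psi> x * (axis j 1 \<bullet> g x))"
        "set_integrable lebesgue ?B (\<lambda>x. \<psi> x * (axis j 1 \<bullet> f x))"
      by (intro set_integrable_mult_continuous set_integrable_component gi fi compact_cball
          flat_algebra_continuous \<psi>(1))+
    from set_integral_diff(2)[OF this] eq
    show "(LINT x:?B|lebesgue. (axis j 1 \<bullet> g x - axis j 1 \<bullet> f x) * \<psi> x) = 0"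
      by (simp add: left_diff_distrib mult.commute[of "\<psi> _"])
  qed
  then have "AE x in lebesgue. \<forall>j. x \<in> ball x0 R \<longrightarrow> axis j 1 \<bullet> g x - axis j 1 \<bullet> f x = 0"
    by (intro AE_all_countable[THEN iffD2]) blast
  then show ?thesis
    by eventually_elim (simp add: vec_eq_iff inner_axis')
qed

text \<open>
  Membership in \<open>W1inf_X_loc\<close> provides some bounded gradient on each relatively compact open set;
  uniqueness transfers the bound to the given gradient \<open>g\<close> on \<open>\<Omega>\<close>.
\<close>

lemma hgrad_locally_bounded:
  fixes C :: "real^'n \<Rightarrow> real^'n^'m"
  assumes hg: "is_hgrad \<Omega> C u g" and u: "u \<in> W1inf_X_loc \<Omega> C"
    and R: "0 < R" "cball x0 (2 * R) \<subseteq> \<Omega>"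
  obtains M where "AE x in lebesgue. x \<in> ball x0 R \<longrightarrow> norm (g x) \<le> M"
proof -
  let ?V = "ball x0 (2 * R)"
  have "open ?V" "compact (closure ?V)" "closure ?V \<subseteq> \<Omega>"
    using R by auto
  then obtain f where f: "f \<in> Linf ?V" "is_hgrad ?V C u f"
    using u unfolding W1inf_X_loc_def by blast
  then obtain M where "AE x in lebesgue_on ?V. norm (f x) \<le> M"
    by (auto simp: Linf_def)
  then have "AE x in lebesgue. x \<in> ?V \<longrightarrow> norm (f x) \<le> M"
    by (simp add: AE_restrict_space_iff)
  moreover have "AE x in lebesgue. x \<in> ball x0 R \<longrightarrow> g x = f x"
    by (rule hgrad_unique[OF hg f(2)]) (use R in \<open>auto simp: subset_iff\<close>)
  ultimately have "AE x in lebesgue. x \<in> ball x0 R \<longrightarrow> norm (g x) \<le> M"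
    by eventually_elim (use R in auto)
  then show ?thesis by (rule that)
qed

section \<open>The viscosity inequality\<close>

text \<open>
  This is where quasiconvexity enters. The sublevel set \<open>S\<close> of \<open>H x0 (v x0)\<close> at half the positive value
  attained at \<open>p0\<close> is closed and convex and misses \<open>p0\<close>, so a hyperplane separates them strictly. Almost
  every value \<open>Xu x\<close> near \<open>x0\<close> lies in \<open>S\<close>, since these values stay in a bounded set, on which \<open>H x (v x)\<close>
  is uniformly close to \<open>H x0 (v x0)\<close>.
\<close>

lemma separating_direction:
  fixes \<Omega> :: "(real^'n) set"
    and C :: "real^'n \<Rightarrow> real^'n^'m"
    and H :: "real^'n \<Rightarrow> real \<Rightarrow> real^'m \<Rightarrow> real"
  assumes "open \<Omega>"
    and H: "continuous_on (\<Omega> \<times> UNIV \<times> UNIV) (\<lambda>(x, s, p). H x s p)"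
    and qc: "\<And>x s. x \<in> \<Omega> \<Longrightarrow> quasiconvex (H x s)"
    and u: "u \<in> W1inf_X_loc \<Omega> C"
    and hg: "is_hgrad \<Omega> C u Xu"
    and sub: "AE x in lebesgue_on \<Omega>. H x (u x) (Xu x) \<le> 0"
    and rep: "continuous_representative \<Omega> u v"
    and x0: "x0 \<in> \<Omega>" and pos: "0 < H x0 (v x0) p0"
  obtains \<xi> \<beta> \<rho> where "\<xi> \<bullet> p0 < \<beta>" "0 < \<rho>"
    "AE x in lebesgue. x \<in> ball x0 \<rho> \<longrightarrow> \<beta> \<le> \<xi> \<bullet> Xu x"
proof -
  define \<delta> where "\<delta> = H x0 (v x0) p0 / 2"
  define S where "S = {p. H x0 (v x0) p \<le> \<delta>}"
  have convS: "convex S"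
    unfolding convex_alt
  proof (intro ballI allI impI)
    fix p q and t :: real assume "p \<in> S" "q \<in> S" "0 \<le> t \<and> t \<le> 1"
    then have "H x0 (v x0) (t *\<^sub>R q + (1 - t) *\<^sub>R p) \<le> max (H x0 (v x0) q) (H x0 (v x0) p)"
      using qc[OF x0, of "v x0"] by (auto simp: quasiconvex_def)
    then show "(1 - t) *\<^sub>R p + t *\<^sub>R q \<in> S"
      using \<open>p \<in> S\<close> \<open>q \<in> S\<close> by (simp add: S_def add.commute)
  qed
  have closS: "closed S"
  proof -
    have "continuous_on UNIV (\<lambda>p. (\<lambda>(x, s, p). H x s p) (x0, v x0, p))"
      by (rule continuous_on_compose2[OF H]) (auto intro!: continuous_intros x0)
    then have "continuous_on UNIV (H x0 (v x0))" by simp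
    then show ?thesis
      unfolding S_def by (rule closed_Collect_le[OF _ continuous_on_const])
  qed
  have p0S: "p0 \<notin> S" using pos by (simp add: S_def \<delta>_def)
  obtain \<xi> \<beta> where sep: "\<xi> \<bullet> p0 < \<beta>" "\<And>p. p \<in> S \<Longrightarrow> \<beta> < \<xi> \<bullet> p"
    using separating_hyperplane_closed_point[OF convS closS p0S] by auto
  obtain R0 where R0: "0 < R0" "cball x0 R0 \<subseteq> \<Omega>"
    using open_contains_cball[of \<Omega>] \<open>open \<Omega>\<close> x0 by auto
  define r where "r = R0 / 2"
  have r: "0 < r" "cball x0 (2 * r) \<subseteq> \<Omega>" "cball x0 r \<subseteq> \<Omega>"
    using R0 by (auto simp: r_def subset_iff)
  obtain M where M: "AE x in lebesgue. x \<in> ball x0 r \<longrightarrow> norm (Xu x) \<le> M"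
    using hgrad_locally_bounded[OF hg u r(1,2)] by blast
  let ?K = "cball x0 r \<times> cball (v x0) 1 \<times> cball (0::real^'m) M"
  have "uniformly_continuous_on ?K (\<lambda>(x, s, p). H x s p)"
    using r(3) by (intro compact_uniformly_continuous continuous_on_subset[OF H] compact_Times) auto
  moreover have "0 < \<delta>" using pos by (simp add: \<delta>_def)
  ultimately obtain d where d: "0 < d" "\<And>z z'. \<lbrakk>z \<in> ?K; z' \<in> ?K; dist z' z < d\<rbrakk> \<Longrightarrow>
      dist ((\<lambda>(x, s, p). H x s p) z') ((\<lambda>(x, s, p). H x s p) z) < \<delta>"
    unfolding uniformly_continuous_on_def by blast
  have "isCont v x0"
    using rep \<open>open \<Omega>\<close> x0 by (simp add: continuous_representative_def continuous_on_eq_continuous_at)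
  moreover have "0 < min 1 (d / 2)" using d(1) by simp
  ultimately obtain \<rho>1 where \<rho>1: "0 < \<rho>1" "\<And>x. dist x x0 < \<rho>1 \<Longrightarrow> dist (v x) (v x0) < min 1 (d / 2)"
    unfolding continuous_at_eps_delta by blast
  define \<rho> where "\<rho> = min (min \<rho>1 r) (d / 2)"
  have \<rho>: "0 < \<rho>" using \<rho>1(1) r(1) d(1) by (simp add: \<rho>_def)
  have in_S: "p \<in> S" if x: "x \<in> ball x0 \<rho>" and p: "norm p \<le> M" and Hx: "H x (v x) p \<le> 0" for x p
  proof -
    have xd: "dist x x0 < \<rho>1" "dist x x0 < r" "dist x x0 < d / 2"
      using x by (auto simp: \<rho>_def dist_commute)
    note vd = \<rho>1(2)[OF xd(1)]
    have "dist (x0, v x0, p) (x, v x, p) \<le> dist x x0 + dist (v x) (v x0)"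
      using sqrt_sum_squares_le_sum[of "dist x x0" "dist (v x) (v x0)"]
      by (simp add: dist_prod_def dist_commute)
    then have "dist (x0, v x0, p) (x, v x, p) < d" using xd(3) vd by linarith
    moreover have "(x, v x, p) \<in> ?K" "(x0, v x0, p) \<in> ?K"
      using xd(2) vd p r(1) by (auto simp: dist_commute)
    ultimately have "dist (H x0 (v x0) p) (H x (v x) p) < \<delta>"
      using d(2)[of "(x, v x, p)" "(x0, v x0, p)"] by simp
    then show ?thesis using Hx by (simp add: S_def dist_real_def)
  qed
  have "AE x in lebesgue. x \<in> \<Omega> \<longrightarrow> H x (u x) (Xu x) \<le> 0"
    using sub \<open>open \<Omega>\<close> by (simp add: AE_restrict_space_iff)
  moreover have "AE x in lebesgue. x \<in> \<Omega> \<longrightarrow> v x = u x"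
    using rep \<open>open \<Omega>\<close> by (simp add: continuous_representative_def AE_restrict_space_iff)
  ultimately have "AE x in lebesgue. x \<in> ball x0 \<rho> \<longrightarrow> \<beta> \<le> \<xi> \<bullet> Xu x"
    using M
  proof eventually_elim
    case (elim x)
    show ?case
    proof
      assume x: "x \<in> ball x0 \<rho>"
      then have "x \<in> ball x0 r" "x \<in> \<Omega>" using r(3) by (auto simp: \<rho>_def subset_iff)
      then have "Xu x \<in> S" using elim x by (intro in_S[of x]) auto
      then show "\<beta> \<le> \<xi> \<bullet> Xu x" using sep(2) less_imp_le by blast
    qed
  qed
  then show ?thesis using that sep(1) \<rho> by blast
qed

text \<open>
  If the inequality fails at \<open>x0\<close>, a direction \<open>\<xi>\<close> separates \<open>X\<phi> x0\<close> from the values of \<open>Xu\<close> near \<open>x0\<close>.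
  Then \<open>v - \<phi>\<close> is weakly strictly increasing along \<open>\<xi> v* C\<close> near its local maximum \<open>x0\<close>, which is
  impossible.
\<close>

theorem theorem3p7:
  fixes \<Omega> :: "(real^'n) set"
    and C :: "real^'n \<Rightarrow> real^'n^'m"
    and H :: "real^'n \<Rightarrow> real \<Rightarrow> real^'m \<Rightarrow> real"
    and u v :: "real^'n \<Rightarrow> real"
    and Xu :: "real^'n \<Rightarrow> real^'m"
  assumes "CARD('m) \<le> CARD('n)"
    and "open \<Omega>" "connected \<Omega>" "\<Omega> \<noteq> {}" "bounded \<Omega>"
    and "smooth_on \<Omega> C"
    and "hormander_on \<Omega> C"
    and "continuous_on (\<Omega> \<times> UNIV \<times> UNIV) (\<lambda>(x, s, p). H x s p)"
    and "\<And>x s. x \<in> \<Omega> \<Longrightarrow> quasiconvex (H x s)"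
    and "u \<in> W1inf_X_loc \<Omega> C"
    and "is_hgrad \<Omega> C u Xu"
    and "AE x in lebesgue_on \<Omega>. H x (u x) (Xu x) \<le> 0"
    and "continuous_representative \<Omega> u v"
  shows "viscosity_subsolution \<Omega> C H v"
proof -
  note C = \<open>smooth_on \<Omega> C\<close> and rep = \<open>continuous_representative \<Omega> u v\<close>
  have contv: "continuous_on \<Omega> v" using rep by (simp add: continuous_representative_def)
  have "H x0 (v x0) (X\<phi> x0) \<le> 0"
    if x0: "x0 \<in> \<Omega>" and \<phi>: "\<phi> \<in> C1_X \<Omega> C" and X\<phi>: "continuous_on \<Omega> X\<phi>" "is_hgrad \<Omega> C \<phi> X\<phi>"
      and max: "eventually (\<lambda>x. v x0 - \<phi> x0 \<ge> v x - \<phi> x) (nhds x0)" for x0 \<phi> X\<phi>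
  proof (rule ccontr)
    assume "\<not> H x0 (v x0) (X\<phi> x0) \<le> 0"
    then have pos: "0 < H x0 (v x0) (X\<phi> x0)" by simp
    obtain \<xi> \<beta> \<rho> where \<xi>: "\<xi> \<bullet> X\<phi> x0 < \<beta>" and \<rho>: "0 < \<rho>"
      and Xu_ge: "AE x in lebesgue. x \<in> ball x0 \<rho> \<longrightarrow> \<beta> \<le> \<xi> \<bullet> Xu x"
      using separating_direction[OF \<open>open \<Omega>\<close> assms(8-13) x0] pos by blast
    define \<epsilon> where "\<epsilon> = (\<beta> - \<xi> \<bullet> X\<phi> x0) / 2"
    have \<epsilon>: "0 < \<epsilon>" using \<xi> by (simp add: \<epsilon>_def)
    have cont\<phi>: "continuous_on \<Omega> \<phi>" using \<phi> by (simp add: C1_X_def)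
    obtain V where V: "open V" "x0 \<in> V" "\<And>x. x \<in> V \<Longrightarrow> v x - \<phi> x \<le> v x0 - \<phi> x0"
      using max unfolding eventually_nhds by blast
    \<comment> \<open>On \<open>U\<close> the maximality, the bound on \<open>Xu\<close> and the bound on \<open>X\<phi>\<close> hold simultaneously.\<close>
    define U where "U = V \<inter> ball x0 \<rho> \<inter> (\<Omega> \<inter> (\<lambda>x. \<xi> \<bullet> X\<phi> x) -` {..< \<beta> - \<epsilon>})"
    have "open (\<Omega> \<inter> (\<lambda>x. \<xi> \<bullet> X\<phi> x) -` {..< \<beta> - \<epsilon>})"
      using X\<phi>(1) \<open>open \<Omega>\<close> by (intro continuous_open_preimage continuous_intros) auto
    then have U_open: "open U" using V(1) by (simp add: U_def open_Int)
    have "\<xi> \<bullet> X\<phi> x0 < \<beta> - \<epsilon>" using \<xi> by (simp add: \<epsilon>_def field_simps)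
    then have U_x0: "x0 \<in> U" using V(2) x0 \<rho> by (simp add: U_def)
    have U: "U \<subseteq> \<Omega>" "U \<subseteq> ball x0 \<rho>" "\<And>x. x \<in> U \<Longrightarrow> \<xi> \<bullet> X\<phi> x < \<beta> - \<epsilon>"
      "\<And>x. x \<in> U \<Longrightarrow> v x - \<phi> x \<le> v x0 - \<phi> x0"
      using V(3) by (auto simp: U_def)
    obtain a b where Q: "cbox a b \<subseteq> U" "x0 \<in> box a b"
      using open_contains_cbox[OF U_open U_x0] by metis
    obtain R where R: "0 < R" "cball x0 R \<subseteq> cbox a b"
      using open_contains_cball[of "box a b"] Q(2) box_subset_cbox[of a b] open_box by blast
    have Q\<Omega>: "cbox a b \<subseteq> \<Omega>" using Q(1) U(1) by blast
    note lin = bounded_linear_vector_matrix_mult[of \<xi>]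
    define Y where "Y x = \<xi> v* C x" for x
    define Y' where "Y' x h = \<xi> v* frechet_derivative C (at x) h" for x h
    show False
    proof (rule no_local_max_if_weakly_increasing[OF \<open>open \<Omega>\<close> Q\<Omega>,
          where Y = Y and Y' = Y' and w = "\<lambda>x. v x - \<phi> x" and ?x0.0 = x0 and R = R and \<epsilon> = \<epsilon>])
      show "(Y has_derivative Y' x) (at x)" if "x \<in> \<Omega>" for x
        unfolding Y_def Y'_def
        by (rule bounded_linear.has_derivative[OF lin smooth_on_derivative(1)[OF C that]])
      show "continuous_on \<Omega> (\<lambda>x. Y' x h)" for h
        unfolding Y'_def by (rule bounded_linear.continuous_on[OF lin smooth_on_derivative(2)[OF C]])
      show "continuous_on (cbox a b) (\<lambda>x. v x - \<phi> x)"
        using contv cont\<phi> Q\<Omega> by (intro continuous_on_diff) (auto intro: continuous_on_subset)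
      show "v x - \<phi> x \<le> v x0 - \<phi> x0" if "x \<in> cball x0 R" for x
        using U(4) Q(1) R(2) that by blast
    next
      fix y :: "real^'n" and \<eta> :: real
      assume \<eta>: "0 < \<eta>" and "cball y \<eta> \<subseteq> cball x0 R"
      then have y: "cball y \<eta> \<subseteq> cbox a b" using R(2) by blast
      let ?Q = "cbox a b"
      let ?D = "\<lambda>x. bump_deriv \<eta> y x (Y x) + bump \<eta> y x * trace (matrix (Y' x))"
      have rep\<phi>: "continuous_representative \<Omega> \<phi> \<phi>"
        using cont\<phi> by (simp add: continuous_representative_def)
      have int: "set_integrable lebesgue ?Q (\<lambda>x. bump \<eta> y x * (\<xi> \<bullet> g x))" if "is_hgrad \<Omega> C f g" for f g
      proof -
        have "set_integrable lebesgue ?Q g"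
          using that Q\<Omega> by (simp add: is_hgrad_def L1_loc_def)
        then show ?thesis
          by (intro set_integrable_mult_continuous set_integrable_component compact_cbox continuous_intros)
      qed
      have intb: "set_integrable lebesgue ?Q (\<lambda>x. bump \<eta> y x * k)" for k
        by (intro absolutely_integrable_continuous continuous_intros)
      have bump: "(LINT x:?Q|lebesgue. bump \<eta> y x * k) = k * integral ?Q (bump \<eta> y)" for k
        by (subst set_lebesgue_integral_eq_integral(2)[OF intb]) (simp add: mult.commute)
      have "(LINT x:?Q|lebesgue. bump \<eta> y x * \<beta>) \<le> (LINT x:?Q|lebesgue. bump \<eta> y x * (\<xi> \<bullet> Xu x))"
      proof (rule set_integral_mono_AE[OF intb int[OF assms(11)]])
        show "AE x\<in>?Q in lebesgue. bump \<eta> y x * \<beta> \<le> bump \<eta> y x * (\<xi> \<bullet> Xu x)"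
          using Xu_ge by eventually_elim (use Q(1) U(2) in \<open>auto intro!: mult_left_mono simp: bump_nonneg\<close>)
      qed
      moreover have "(LINT x:?Q|lebesgue. bump \<eta> y x * (\<xi> \<bullet> X\<phi> x)) \<le> (LINT x:?Q|lebesgue. bump \<eta> y x * (\<beta> - \<epsilon>))"
      proof (rule set_integral_mono_AE[OF int[OF X\<phi>(2)] intb], intro AE_I2 impI)
        fix x assume "x \<in> ?Q"
        then have "\<xi> \<bullet> X\<phi> x \<le> \<beta> - \<epsilon>" using U(3)[of x] Q(1) by (auto simp: less_imp_le)
        then show "bump \<eta> y x * (\<xi> \<bullet> X\<phi> x) \<le> bump \<eta> y x * (\<beta> - \<epsilon>)"
          by (intro mult_left_mono bump_nonneg)
      qed
      ultimately have "\<epsilon> * integral ?Q (bump \<eta> y)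
          \<le> (LINT x:?Q|lebesgue. bump \<eta> y x * (\<xi> \<bullet> Xu x)) - (LINT x:?Q|lebesgue. bump \<eta> y x * (\<xi> \<bullet> X\<phi> x))"
        unfolding bump left_diff_distrib by linarith
      also have "\<dots> = - integral ?Q (\<lambda>x. v x * ?D x) - - integral ?Q (\<lambda>x. \<phi> x * ?D x)"
        unfolding Y_def Y'_def
        by (simp only: hgrad_against_bump[OF \<open>open \<Omega>\<close> C assms(11) rep Q\<Omega> \<eta> y]
            hgrad_against_bump[OF \<open>open \<Omega>\<close> C X\<phi>(2) rep\<phi> Q\<Omega> \<eta> y])
      also have "\<dots> = - (integral ?Q (\<lambda>x. v x * ?D x) - integral ?Q (\<lambda>x. \<phi> x * ?D x))"
        by simp
      also have "\<dots> = - integral ?Q (\<lambda>x. v x * ?D x - \<phi> x * ?D x)"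
      proof (subst Henstock_Kurzweil_Integration.integral_diff)
        have contC: "continuous_on ?Q C"
          using has_derivative_continuous[OF smooth_on_derivative(1)[OF C]] Q\<Omega>
          by (intro continuous_at_imp_continuous_on) blast
        have contY: "continuous_on ?Q Y" "continuous_on ?Q (\<lambda>x. Y' x h)" for h
          unfolding Y_def Y'_def
          using contC continuous_on_subset[OF smooth_on_derivative(2)[OF C] Q\<Omega>]
          by (auto intro: bounded_linear.continuous_on[OF lin])
        then have D: "continuous_on ?Q ?D"
          unfolding trace_def matrix_def by (auto intro!: continuous_intros)
        then show "(\<lambda>x. v x * ?D x) integrable_on ?Q" "(\<lambda>x. \<phi> x * ?D x) integrable_on ?Q"
          using continuous_on_subset[OF contv Q\<Omega>] continuous_on_subset[OF cont\<phi> Q\<Omega>]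
          by (auto intro!: integrable_continuous continuous_on_mult)
      qed simp
      finally show "\<epsilon> * integral ?Q (bump \<eta> y) \<le> - integral ?Q (\<lambda>x. (v x - \<phi> x) * ?D x)"
        by (simp only: left_diff_distrib)
    qed (use R \<epsilon> in auto)
  qed
  moreover have "usc_on \<Omega> v"
    unfolding usc_on_def using contv
    by (auto simp: continuous_on_def intro: order_tendstoD(2))
  ultimately show ?thesis by (auto simp: viscosity_subsolution_def)
qed

end
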